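(* Let $G$ be a finite group, $k$ a field, and suppose that $G$ acts linearly and faithfully on a finite-dimensional $k$-vector space $V=V_1\oplus \dots\oplus V_r$, where each $V_j$ is a (not necessarily faithful) $G$-subrepresentation. Let $G_j$ be the image of $G$ in $GL(V_j)$ for each $j$. Then $$\operatorname{topdeg}(G,V)\leq \sum_{j=1}^r \operatorname{topdeg}(G_j,V_j)$$ and $$D_{\mathrm{span}}(G,V)\leq \sum_{j=1}^r D_{\mathrm{span}}(G_j,V_j).$$ The natural homomorphism $G\to G_1\times\dots\times G_r$ is injective and makes $G$ a subdirect product of $G_1,\dots,G_r$; if the product is direct (i.e. this homomorphism is an isomorphism), then also $$\beta_{\mathrm{field}}(G,V)\leq\max_{1\le j\le r} \beta_{\mathrm{field}}(G_j,V_j).$$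
   Context: For a finite-dimensional representation $V$ of a finite group $G$ over a field $k$: $k[V]$ is the ring of polynomial functions on $V$ (the symmetric algebra of $V^*$), with $G$-action $(gf)(v)=f(g^{-1}v)$; $k(V)$ is its fraction field; $k[V]^G$ and $k(V)^G$ are the $G$-invariants; $k[V]_{\le d}$ is the space of polynomials of degree at most $d$ and $k[V]^G_{\le d}$ its subspace of invariants. All minima are over $d\in\mathbb{N}=\{0,1,2,\dots\}$. $\operatorname{topdeg}(G,V)$ is the minimum $d$ such that $k[V]_{\le d}$ generates $k[V]$ as a module over $k[V]^G$. $D_{\mathrm{span}}(G,V)$ is the minimum $d$ such that $k[V]_{\le d}$ spans $k(V)$ as a $k(V)^G$-vector space. $\beta_{\mathrm{field}}(G,V)$ is the minimum $d$ such that $k(V)^G$ is generated, as a field extension of $k$, by $k[V]^G_{\le d}$. *)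

theory Defs
  imports
    "HOL-Library.Poly_Mapping"
    "HOL-Computational_Algebra.Computational_Algebra"
    "HOL-Algebra.Algebra"
    "HOL-Algebra.Algebraic_Closure_Type"
begin

section \<open>Linear representations\<close>

text \<open>
  A vector space over the field type \<open>'k\<close> is a subspace \<open>V\<close> of a type \<open>'v\<close> on which
  \<open>scale\<close> is a scalar multiplication (\<^locale>\<open>vector_space\<close>), so that subrepresentations have
  the same type as the representation they sit in.
\<close>

definition findim_space :: "('k::field \<Rightarrow> 'v::ab_group_add \<Rightarrow> 'v) \<Rightarrow> 'v set \<Rightarrow> bool" where
  "findim_space scale V \<longleftrightarrow> (\<exists>B. finite B \<and> module.span scale B = V)"

definition GL :: "('k::field \<Rightarrow> 'v::ab_group_add \<Rightarrow> 'v) \<Rightarrow> 'v set \<Rightarrow> ('v \<Rightarrow> 'v) monoid" where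
  "GL scale V = (BijGroup V)\<lparr>carrier := {f \<in> Bij V.
      (\<forall>x\<in>V. \<forall>y\<in>V. f (x + y) = f x + f y) \<and> (\<forall>c. \<forall>x\<in>V. f (scale c x) = scale c (f x))}\<rparr>"

definition linear_rep ::
    "('k::field \<Rightarrow> 'v::ab_group_add \<Rightarrow> 'v) \<Rightarrow> ('g, 'm) monoid_scheme \<Rightarrow> 'v set
      \<Rightarrow> ('g \<Rightarrow> 'v \<Rightarrow> 'v) \<Rightarrow> bool" where
  "linear_rep scale G V \<rho> \<longleftrightarrow> \<rho> \<in> hom G (GL scale V)"

definition subrep ::
    "('k::field \<Rightarrow> 'v::ab_group_add \<Rightarrow> 'v) \<Rightarrow> ('g, 'm) monoid_scheme
      \<Rightarrow> ('g \<Rightarrow> 'v \<Rightarrow> 'v) \<Rightarrow> 'v set \<Rightarrow> bool" where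
  "subrep scale G \<rho> W \<longleftrightarrow> module.subspace scale W \<and> (\<forall>g\<in>carrier G. \<rho> g ` W \<subseteq> W)"

definition restrict_rep :: "('g \<Rightarrow> 'v \<Rightarrow> 'v) \<Rightarrow> 'v set \<Rightarrow> 'g \<Rightarrow> 'v \<Rightarrow> 'v" where
  "restrict_rep \<rho> W = (\<lambda>g. restrict (\<rho> g) W)"

text \<open>The image of \<open>G\<close> in \<open>GL(W)\<close>; it acts on \<open>W\<close> tautologically, i.e. by \<open>\<lambda>f. f\<close>.\<close>

definition rep_image ::
    "('k::field \<Rightarrow> 'v::ab_group_add \<Rightarrow> 'v) \<Rightarrow> ('g, 'm) monoid_scheme
      \<Rightarrow> ('g \<Rightarrow> 'v \<Rightarrow> 'v) \<Rightarrow> 'v set \<Rightarrow> ('v \<Rightarrow> 'v) monoid" where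
  "rep_image scale G \<rho> W = (GL scale W)\<lparr>carrier := restrict_rep \<rho> W ` carrier G\<rparr>"

definition internal_direct_sum :: "'i set \<Rightarrow> ('i \<Rightarrow> 'v::ab_group_add set) \<Rightarrow> 'v set \<Rightarrow> bool" where
  "internal_direct_sum I W V \<longleftrightarrow> bij_betw (\<lambda>w. \<Sum>i\<in>I. w i) (\<Pi>\<^sub>E i\<in>I. W i) V"

definition natural_map :: "('g \<Rightarrow> 'v \<Rightarrow> 'v) \<Rightarrow> 'i set \<Rightarrow> ('i \<Rightarrow> 'v set) \<Rightarrow> 'g \<Rightarrow> 'i \<Rightarrow> 'v \<Rightarrow> 'v" where
  "natural_map \<rho> I W = (\<lambda>g. \<lambda>i\<in>I. restrict_rep \<rho> (W i) g)"

definition subdirect_product :: "'i set \<Rightarrow> ('i \<Rightarrow> ('a, 'b) monoid_scheme) \<Rightarrow> ('i \<Rightarrow> 'a) set \<Rightarrow> bool" where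
  "subdirect_product I Gs H \<longleftrightarrow>
     subgroup H (product_group I Gs) \<and> (\<forall>i\<in>I. (\<lambda>x. x i) ` H = carrier (Gs i))"


section \<open>The ring of polynomial functions and its fraction field\<close>

type_synonym 'k mpoly = "(nat \<Rightarrow>\<^sub>0 nat) \<Rightarrow>\<^sub>0 'k"

definition pvar :: "nat \<Rightarrow> 'k::field mpoly" where
  "pvar i = Poly_Mapping.single (Poly_Mapping.single i 1) 1"

definition pconst :: "'k \<Rightarrow> 'k::field mpoly" where
  "pconst c = Poly_Mapping.single 0 c"

definition psubst :: "(nat \<Rightarrow> 'k mpoly) \<Rightarrow> 'k::field mpoly \<Rightarrow> 'k mpoly" where
  "psubst \<theta> p = (\<Sum>m\<in>Poly_Mapping.keys p. pconst (Poly_Mapping.lookup p m) *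
      (\<Prod>i\<in>Poly_Mapping.keys m. \<theta> i ^ Poly_Mapping.lookup m i))"

text \<open>
  The symmetric algebra of \<open>V\<^sup>*\<close> is the polynomial ring in the coordinate functions
  \<open>x\<^sub>0, \<dots>, x\<^sub>n\<^sub>-\<^sub>1\<close> of an ordered basis \<open>b\<^sub>0, \<dots>, b\<^sub>n\<^sub>-\<^sub>1\<close> of \<open>V\<close>. A basis is chosen once and for
  all for each \<open>V\<close>. Another basis yields a ring that is isomorphic by a linear change of
  variables, which respects the action and the degree, so the numerical invariants below do not
  depend on the choice. The elements are formal polynomials, not functions: the two differ over
  finite fields.
\<close>

definition basis_of :: "('k::field \<Rightarrow> 'v::ab_group_add \<Rightarrow> 'v) \<Rightarrow> 'v set \<Rightarrow> 'v list" where
  "basis_of scale V =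
     (SOME bs. distinct bs \<and> \<not> module.dependent scale (set bs) \<and> module.span scale (set bs) = V)"

definition poly_ring :: "('k::field \<Rightarrow> 'v::ab_group_add \<Rightarrow> 'v) \<Rightarrow> 'v set \<Rightarrow> 'k mpoly set" where
  "poly_ring scale V =
     {p. \<forall>m\<in>Poly_Mapping.keys p. Poly_Mapping.keys m \<subseteq> {..<length (basis_of scale V)}}"

definition poly_ring_le :: "('k::field \<Rightarrow> 'v::ab_group_add \<Rightarrow> 'v) \<Rightarrow> 'v set \<Rightarrow> nat \<Rightarrow> 'k mpoly set" where
  "poly_ring_le scale V d =
     {p \<in> poly_ring scale V. \<forall>m\<in>Poly_Mapping.keys p.
        (\<Sum>i\<in>Poly_Mapping.keys m. Poly_Mapping.lookup m i) \<le> d}"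

text \<open>
  The action \<open>(g f)(v) = f (g\<^sup>-\<^sup>1 v)\<close>: as \<open>v = \<Sum>\<^sub>j x\<^sub>j(v) b\<^sub>j\<close>, it is the substitution
  \<open>x\<^sub>i \<mapsto> \<Sum>\<^sub>j x\<^sub>i(g\<^sup>-\<^sup>1 b\<^sub>j) x\<^sub>j\<close>.
\<close>

definition poly_act ::
    "('k::field \<Rightarrow> 'v::ab_group_add \<Rightarrow> 'v) \<Rightarrow> ('g, 'm) monoid_scheme \<Rightarrow> 'v set
      \<Rightarrow> ('g \<Rightarrow> 'v \<Rightarrow> 'v) \<Rightarrow> 'g \<Rightarrow> 'k mpoly \<Rightarrow> 'k mpoly" where
  "poly_act scale G V \<rho> g =
     (let bs = basis_of scale V in
      psubst (\<lambda>i. \<Sum>j<length bs.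
        pconst (module.representation scale (set bs) (\<rho> (inv\<^bsub>G\<^esub> g) (bs ! j)) (bs ! i)) * pvar j))"

definition poly_inv ::
    "('k::field \<Rightarrow> 'v::ab_group_add \<Rightarrow> 'v) \<Rightarrow> ('g, 'm) monoid_scheme \<Rightarrow> 'v set
      \<Rightarrow> ('g \<Rightarrow> 'v \<Rightarrow> 'v) \<Rightarrow> 'k mpoly set" where
  "poly_inv scale G V \<rho> = {p \<in> poly_ring scale V. \<forall>g\<in>carrier G. poly_act scale G V \<rho> g p = p}"

definition frac_field :: "('k::field \<Rightarrow> 'v::ab_group_add \<Rightarrow> 'v) \<Rightarrow> 'v set \<Rightarrow> 'k mpoly fract set" where
  "frac_field scale V = {Fract p q | p q. p \<in> poly_ring scale V \<and> q \<in> poly_ring scale V \<and> q \<noteq> 0}"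

text \<open>
  \<open>g (p/q) = (g p)/(g q)\<close>; as \<open>g\<close> acts on \<open>k[V]\<close> by an injective ring homomorphism, the result
  does not depend on the representation \<open>p/q\<close>.
\<close>

definition frac_act ::
    "('k::field \<Rightarrow> 'v::ab_group_add \<Rightarrow> 'v) \<Rightarrow> ('g, 'm) monoid_scheme \<Rightarrow> 'v set
      \<Rightarrow> ('g \<Rightarrow> 'v \<Rightarrow> 'v) \<Rightarrow> 'g \<Rightarrow> 'k mpoly fract \<Rightarrow> 'k mpoly fract" where
  "frac_act scale G V \<rho> g x =
     (THE y. \<exists>p\<in>poly_ring scale V. \<exists>q\<in>poly_ring scale V.
        q \<noteq> 0 \<and> x = Fract p q \<and> y = Fract (poly_act scale G V \<rho> g p) (poly_act scale G V \<rho> g q))"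

definition frac_inv ::
    "('k::field \<Rightarrow> 'v::ab_group_add \<Rightarrow> 'v) \<Rightarrow> ('g, 'm) monoid_scheme \<Rightarrow> 'v set
      \<Rightarrow> ('g \<Rightarrow> 'v \<Rightarrow> 'v) \<Rightarrow> 'k mpoly fract set" where
  "frac_inv scale G V \<rho> = {x \<in> frac_field scale V. \<forall>g\<in>carrier G. frac_act scale G V \<rho> g x = x}"


section \<open>The numerical invariants\<close>

text \<open>The module generated by \<open>S\<close> over a subring \<open>R\<close>; the library's span is over a whole type.\<close>

definition span_over :: "'a::comm_ring_1 set \<Rightarrow> 'a set \<Rightarrow> 'a set" where
  "span_over R S = {(\<Sum>s\<in>F. a s * s) | F a. finite F \<and> F \<subseteq> S \<and> (\<forall>s\<in>F. a s \<in> R)}"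

definition topdeg ::
    "('k::field \<Rightarrow> 'v::ab_group_add \<Rightarrow> 'v) \<Rightarrow> ('g, 'm) monoid_scheme \<Rightarrow> 'v set
      \<Rightarrow> ('g \<Rightarrow> 'v \<Rightarrow> 'v) \<Rightarrow> nat" where
  "topdeg scale G V \<rho> =
     (LEAST d. span_over (poly_inv scale G V \<rho>) (poly_ring_le scale V d) = poly_ring scale V)"

definition D_span ::
    "('k::field \<Rightarrow> 'v::ab_group_add \<Rightarrow> 'v) \<Rightarrow> ('g, 'm) monoid_scheme \<Rightarrow> 'v set
      \<Rightarrow> ('g \<Rightarrow> 'v \<Rightarrow> 'v) \<Rightarrow> nat" where
  "D_span scale G V \<rho> =
     (LEAST d. span_over (frac_inv scale G V \<rho>) (to_fract ` poly_ring_le scale V d)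
                 = frac_field scale V)"

definition beta_field ::
    "('k::field \<Rightarrow> 'v::ab_group_add \<Rightarrow> 'v) \<Rightarrow> ('g, 'm) monoid_scheme \<Rightarrow> 'v set
      \<Rightarrow> ('g \<Rightarrow> 'v \<Rightarrow> 'v) \<Rightarrow> nat" where
  "beta_field scale G V \<rho> =
     (LEAST d. generate_field ring_of_type_algebra
                 (to_fract ` (range pconst \<union> (poly_inv scale G V \<rho> \<inter> poly_ring_le scale V d)))
               = frac_inv scale G V \<rho>)"

end

theory Submission
  imports Defs
begin

text \<open>
  Pullback along the projection \<open>V \<rightarrow> V\<^sub>j\<close> embeds \<open>k[V\<^sub>j]\<close> equivariantly in \<open>k[V]\<close>, without raising
  degrees, and \<open>k[V]\<close> is spanned over \<open>k\<close> by products of one element from each \<open>k[V\<^sub>j]\<close>. Writing each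
  factor in generators of degree at most \<open>d\<^sub>j\<close> over the invariants (after multiplication by a
  nonzero invariant, for \<open>D\<^sub>s\<^sub>p\<^sub>a\<^sub>n\<close>) gives generators of \<open>k[V]\<close> of degree at most \<open>\<Sum>\<^sub>j d\<^sub>j\<close>.

  For a direct product, \<open>Tr\<^sub>G (\<Prod>\<^sub>j f\<^sub>j) = \<Prod>\<^sub>j Tr\<^bsub>G\<^sub>j\<^esub> f\<^sub>j\<close>, so every trace from \<open>G\<close> lies in the compositum of
  the invariant fields of the \<open>G\<^sub>j\<close>. By Dedekind's independence of characters there is a product \<open>e\<close>
  with nonzero trace, and then \<open>p = Tr\<^sub>G (p e) / Tr\<^sub>G e\<close> for every invariant \<open>p\<close>. Integrality of
  \<open>k[V]\<close> over the coefficients of the orbit polynomials shows that all the minima exist.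
\<close>

section \<open>Substitution in polynomials\<close>

text \<open>The characteristic of k may divide the group order, and then the trace of 1 vanishes and
  averaging is impossible. Dedekind's theorem supplies another element of nonzero trace:
  faithfulness makes the group elements distinct as characters of the polynomial ring. This is also
  why traces on a summand are taken over the image group; a sum over G would acquire the order of
  the kernel as a factor, possibly 0 in k.

  Existence of the minima is no formality. \<open>LEAST\<close> over an empty set of degrees has no
  known value, so the bounds cannot even be started before the degrees on the right are known to be
  attained.

  Polynomials are formal, so action, projection and restriction cannot be treated by evaluation. All
  three are substitutions of pulled-back linear forms, and one contravariance law for composites
  yields every compatibility between them.

  The embeddings of the summand rings are defined on polynomials only. Statements about fractions
  are therefore reduced to polynomials by clearing invariant denominators, or carried through as
  pairs of numerator and denominator.\<close>

definition mon_deg :: "(nat \<Rightarrow>\<^sub>0 nat) \<Rightarrow> nat" where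
  "mon_deg m = (\<Sum>i\<in>Poly_Mapping.keys m. Poly_Mapping.lookup m i)"

definition polys_in :: "nat set \<Rightarrow> 'k::field mpoly set" where
  "polys_in N = {p. \<forall>m\<in>Poly_Mapping.keys p. Poly_Mapping.keys m \<subseteq> N}"

definition polys_le :: "nat \<Rightarrow> 'k::field mpoly set" where
  "polys_le d = {p. \<forall>m\<in>Poly_Mapping.keys p. mon_deg m \<le> d}"

definition mon_subst :: "(nat \<Rightarrow> 'k::field mpoly) \<Rightarrow> (nat \<Rightarrow>\<^sub>0 nat) \<Rightarrow> 'k mpoly" where
  "mon_subst \<theta> m = (\<Prod>i\<in>Poly_Mapping.keys m. \<theta> i ^ Poly_Mapping.lookup m i)"

text \<open>Lookups vanish off the keys, so monomials with different supports can be summed over one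
  common finite index set.\<close>

lemma mon_deg_superset:
  assumes "finite S" "Poly_Mapping.keys m \<subseteq> S"
  shows "mon_deg m = (\<Sum>i\<in>S. Poly_Mapping.lookup m i)"
  unfolding mon_deg_def using assms
  by (intro sum.mono_neutral_left) (auto simp: in_keys_iff)

lemma keys_add_nat: "Poly_Mapping.keys (m + m') = Poly_Mapping.keys m \<union> Poly_Mapping.keys m'"
  for m m' :: "nat \<Rightarrow>\<^sub>0 nat"
  by (auto simp: in_keys_iff lookup_add)

lemma mon_deg_add: "mon_deg (m + m') = mon_deg m + mon_deg m'"
proof -
  let ?S = "Poly_Mapping.keys m \<union> Poly_Mapping.keys m'"
  have "mon_deg (m + m') = (\<Sum>i\<in>?S. Poly_Mapping.lookup (m + m') i)"
    by (intro mon_deg_superset) (auto simp: keys_add_nat)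
  also have "\<dots> = mon_deg m + mon_deg m'"
    by (simp add: lookup_add sum.distrib mon_deg_superset[of ?S])
  finally show ?thesis .
qed

lemma mon_subst_superset:
  assumes "finite S" "Poly_Mapping.keys m \<subseteq> S"
  shows "mon_subst \<theta> m = (\<Prod>i\<in>S. \<theta> i ^ Poly_Mapping.lookup m i)"
  unfolding mon_subst_def using assms
  by (intro prod.mono_neutral_left) (auto simp: in_keys_iff)

lemma mon_subst_add: "mon_subst \<theta> (m + m') = mon_subst \<theta> m * mon_subst \<theta> m'"
proof -
  let ?S = "Poly_Mapping.keys m \<union> Poly_Mapping.keys m'"
  have "mon_subst \<theta> (m + m') = (\<Prod>i\<in>?S. \<theta> i ^ Poly_Mapping.lookup (m + m') i)"
    by (intro mon_subst_superset) (auto simp: keys_add_nat)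
  also have "\<dots> = mon_subst \<theta> m * mon_subst \<theta> m'"
    by (simp add: lookup_add power_add prod.distrib mon_subst_superset[of ?S])
  finally show ?thesis .
qed

lemma sum_singles: "(\<Sum>m\<in>Poly_Mapping.keys p. Poly_Mapping.single m (Poly_Mapping.lookup p m)) = p"
proof (rule poly_mapping_eqI)
  fix k
  have "Poly_Mapping.lookup (\<Sum>m\<in>Poly_Mapping.keys p. Poly_Mapping.single m (Poly_Mapping.lookup p m)) k
    = (\<Sum>m\<in>Poly_Mapping.keys p. if m = k then Poly_Mapping.lookup p m else 0)"
    unfolding lookup_sum by (intro sum.cong) (auto simp: lookup_single when_def)
  also have "\<dots> = Poly_Mapping.lookup p k"
    by (simp add: sum.delta in_keys_iff)
  finally show "Poly_Mapping.lookup (\<Sum>m\<in>Poly_Mapping.keys p. Poly_Mapping.single m (Poly_Mapping.lookup p m)) k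
    = Poly_Mapping.lookup p k" .
qed

lemma pconst_0 [simp]: "pconst 0 = 0"
  and pconst_1 [simp]: "pconst 1 = 1"
  and pconst_add: "pconst (a + b) = pconst a + pconst b"
  and pconst_mult: "pconst (a * b) = pconst a * pconst b"
  by (simp_all add: pconst_def single_add mult_single)

lemma pconst_uminus: "pconst (- a) = - pconst a"
  by (simp add: pconst_def single_uminus)

lemma pconst_sum: "pconst (sum f S) = (\<Sum>i\<in>S. pconst (f i))"
  by (induction S rule: infinite_finite_induct) (auto simp: pconst_add)

lemma psubst_superset:
  assumes "finite S" "Poly_Mapping.keys p \<subseteq> S"
  shows "psubst \<theta> p = (\<Sum>m\<in>S. pconst (Poly_Mapping.lookup p m) * mon_subst \<theta> m)"
  unfolding psubst_def mon_subst_def using assms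
  by (intro sum.mono_neutral_left) (auto simp: in_keys_iff)

lemma psubst_0 [simp]: "psubst \<theta> 0 = 0"
  by (simp add: psubst_def)

lemma psubst_add: "psubst \<theta> (p + q) = psubst \<theta> p + psubst \<theta> q"
proof -
  let ?S = "Poly_Mapping.keys p \<union> Poly_Mapping.keys q"
  have "psubst \<theta> (p + q) = (\<Sum>m\<in>?S. pconst (Poly_Mapping.lookup (p + q) m) * mon_subst \<theta> m)"
    by (intro psubst_superset) (auto simp: Poly_Mapping.keys_add)
  also have "\<dots> = psubst \<theta> p + psubst \<theta> q"
    by (simp add: lookup_add pconst_add algebra_simps sum.distrib psubst_superset[of ?S])
  finally show ?thesis .
qed

lemma psubst_sum: "psubst \<theta> (sum f S) = (\<Sum>i\<in>S. psubst \<theta> (f i))"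
  by (induction S rule: infinite_finite_induct) (auto simp: psubst_add)

lemma psubst_single: "psubst \<theta> (Poly_Mapping.single m c) = pconst c * mon_subst \<theta> m"
  using psubst_superset[of "{m}" "Poly_Mapping.single m c" \<theta>] by simp

text \<open>Expanding both factors into monomials reduces the claim to bilinearity and
  \<open>mon_subst_add\<close>.\<close>

lemma psubst_mult: "psubst \<theta> (p * q) = psubst \<theta> p * psubst \<theta> q"
proof -
  have "psubst \<theta> (p * q) =
    psubst \<theta> ((\<Sum>m\<in>Poly_Mapping.keys p. Poly_Mapping.single m (Poly_Mapping.lookup p m)) *
      (\<Sum>m\<in>Poly_Mapping.keys q. Poly_Mapping.single m (Poly_Mapping.lookup q m)))"
    by (simp only: sum_singles)
  also have "\<dots> =
    psubst \<theta> (\<Sum>m\<in>Poly_Mapping.keys p. Poly_Mapping.single m (Poly_Mapping.lookup p m)) *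
    psubst \<theta> (\<Sum>m\<in>Poly_Mapping.keys q. Poly_Mapping.single m (Poly_Mapping.lookup q m))"
    by (simp add: sum_product psubst_sum psubst_single mult_single mon_subst_add pconst_mult algebra_simps)
  finally show ?thesis by (simp only: sum_singles)
qed

lemma psubst_pconst [simp]: "psubst \<theta> (pconst c) = pconst c"
  by (simp add: pconst_def[of c] psubst_single mon_subst_def)

lemma psubst_1 [simp]: "psubst \<theta> 1 = 1"
  using psubst_pconst[of \<theta> 1] by simp

lemma psubst_uminus: "psubst \<theta> (- p) = - psubst \<theta> p"
  using psubst_add[of \<theta> p "- p"] by (simp add: minus_unique)

lemma psubst_prod: "psubst \<theta> (prod f S) = (\<Prod>i\<in>S. psubst \<theta> (f i))"
  by (induction S rule: infinite_finite_induct) (auto simp: psubst_mult)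

lemma psubst_pvar [simp]: "psubst \<theta> (pvar i) = \<theta> i"
  by (simp add: pvar_def psubst_single mon_subst_def)

lemma mon_subst_pvar: "mon_subst pvar m = Poly_Mapping.single m 1"
proof -
  have pow: "pvar i ^ e = Poly_Mapping.single (Poly_Mapping.single i e) 1" for i e
    by (induction e) (simp_all add: pvar_def mult_single single_add[symmetric])
  have prod: "(\<Prod>i\<in>S. Poly_Mapping.single (f i) 1) = Poly_Mapping.single (sum f S) 1"
    if "finite S" for f :: "nat \<Rightarrow> nat \<Rightarrow>\<^sub>0 nat" and S
    using that by induction (auto simp: mult_single)
  show ?thesis
    by (simp add: mon_subst_def pow prod sum_singles)
qed

text \<open>Read backwards, this exhibits \<open>p\<close> as built from constants and variables;
  \<open>polys_in_induct\<close> and \<open>A_subset_span\<close> start that way.\<close>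

lemma psubst_id [simp]: "psubst pvar p = p"
proof -
  have "psubst pvar p = (\<Sum>m\<in>Poly_Mapping.keys p. Poly_Mapping.single m (Poly_Mapping.lookup p m))"
    by (simp add: psubst_superset[of "Poly_Mapping.keys p"] mon_subst_pvar pconst_def mult_single)
  then show ?thesis by (simp add: sum_singles)
qed

section \<open>Variable support and degree bounds\<close>

lemma polys_in_0 [simp]: "0 \<in> polys_in N"
  and polys_in_pconst [simp]: "pconst c \<in> polys_in N"
  and polys_in_add: "p \<in> polys_in N \<Longrightarrow> q \<in> polys_in N \<Longrightarrow> p + q \<in> polys_in N"
  and polys_in_pvar: "i \<in> N \<Longrightarrow> pvar i \<in> polys_in N"
  using Poly_Mapping.keys_add[of p q]
  by (auto simp: polys_in_def pconst_def pvar_def split: if_splits)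

lemma polys_in_1 [simp]: "1 \<in> polys_in N"
  using polys_in_pconst[of 1] by simp

lemma polys_in_mult: "p \<in> polys_in N \<Longrightarrow> q \<in> polys_in N \<Longrightarrow> p * q \<in> polys_in N"
  using Poly_Mapping.keys_mult[of p q] unfolding polys_in_def keys_add_nat
  by (fastforce simp: keys_add_nat)

lemma polys_le_0 [simp]: "0 \<in> polys_le d"
  and polys_le_pconst [simp]: "pconst c \<in> polys_le d"
  and polys_le_add: "p \<in> polys_le d \<Longrightarrow> q \<in> polys_le d \<Longrightarrow> p + q \<in> polys_le d"
  and polys_le_pvar: "1 \<le> d \<Longrightarrow> pvar i \<in> polys_le d"
  and polys_le_mono: "d \<le> d' \<Longrightarrow> p \<in> polys_le d \<Longrightarrow> p \<in> polys_le d'"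
  using Poly_Mapping.keys_add[of p q]
  by (auto simp: polys_le_def pconst_def pvar_def mon_deg_def split: if_splits)

lemma polys_le_1 [simp]: "1 \<in> polys_le d"
  using polys_le_pconst[of 1] by simp

lemma polys_le_mult: "p \<in> polys_le d \<Longrightarrow> q \<in> polys_le d' \<Longrightarrow> p * q \<in> polys_le (d + d')"
  using Poly_Mapping.keys_mult[of p q] unfolding polys_le_def
  by (fastforce simp: mon_deg_add intro: add_mono)

lemma polys_in_uminus: "p \<in> polys_in N \<Longrightarrow> - p \<in> polys_in N"
  using polys_in_mult[OF polys_in_pconst[of "-1"]] by (force simp: pconst_uminus)

lemma polys_le_uminus: "p \<in> polys_le d \<Longrightarrow> - p \<in> polys_le d"
  using polys_le_mult[OF polys_le_pconst[of "-1" 0]] by (force simp: pconst_uminus)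

lemma polys_in_sum: "(\<And>i. i \<in> S \<Longrightarrow> f i \<in> polys_in N) \<Longrightarrow> sum f S \<in> polys_in N"
  by (induction S rule: infinite_finite_induct) (auto simp: polys_in_add)

lemma polys_in_prod: "(\<And>i. i \<in> S \<Longrightarrow> f i \<in> polys_in N) \<Longrightarrow> prod f S \<in> polys_in N"
  by (induction S rule: infinite_finite_induct) (auto simp: polys_in_mult)

lemma polys_in_power: "p \<in> polys_in N \<Longrightarrow> p ^ e \<in> polys_in N"
  by (induction e) (auto simp: polys_in_mult)

lemma polys_le_sum: "(\<And>i. i \<in> S \<Longrightarrow> f i \<in> polys_le d) \<Longrightarrow> sum f S \<in> polys_le d"
  by (induction S rule: infinite_finite_induct) (auto simp: polys_le_add)

lemma polys_le_prod: "(\<And>i. i \<in> S \<Longrightarrow> f i \<in> polys_le (d i)) \<Longrightarrow> prod f S \<in> polys_le (sum d S)"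
  by (induction S rule: infinite_finite_induct) (auto simp: polys_le_mult)

lemma polys_le_power: "p \<in> polys_le d \<Longrightarrow> p ^ e \<in> polys_le (e * d)"
  by (induction e) (auto simp: polys_le_mult)

lemma ex_polys_le: "\<exists>d. p \<in> polys_le d"
proof -
  have "p \<in> polys_le (\<Sum>m\<in>Poly_Mapping.keys p. mon_deg m)"
    unfolding polys_le_def by (auto intro: member_le_sum)
  then show ?thesis by blast
qed

text \<open>Together with \<open>psubst_le\<close> this places the images of the group action and of
  pullbacks in the right polynomial ring.\<close>

lemma psubst_in:
  assumes "p \<in> polys_in N" "\<And>i. i \<in> N \<Longrightarrow> \<theta> i \<in> polys_in N'"
  shows "psubst \<theta> p \<in> polys_in N'"
  unfolding psubst_def using assms
  by (intro polys_in_sum polys_in_mult polys_in_prod polys_in_power) (auto simp: polys_in_def[of N])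

text \<open>A monomial of degree \<open>e\<close> becomes a constant times a product of
  \<open>e\<close> factors of degree at most 1.\<close>

lemma psubst_le:
  assumes "p \<in> polys_le d" "\<And>i. \<theta> i \<in> polys_le 1"
  shows "psubst \<theta> p \<in> polys_le d"
  unfolding psubst_def
proof (rule polys_le_sum)
  fix m assume m: "m \<in> Poly_Mapping.keys p"
  have "pconst (Poly_Mapping.lookup p m) * (\<Prod>i\<in>Poly_Mapping.keys m. \<theta> i ^ Poly_Mapping.lookup m i)
    \<in> polys_le (0 + (\<Sum>i\<in>Poly_Mapping.keys m. Poly_Mapping.lookup m i * 1))"
    by (intro polys_le_mult polys_le_prod polys_le_power polys_le_pconst assms)
  then show "pconst (Poly_Mapping.lookup p m) * (\<Prod>i\<in>Poly_Mapping.keys m. \<theta> i ^ Poly_Mapping.lookup m i)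
    \<in> polys_le d"
    using assms(1) m by (intro polys_le_mono[of _ d]) (auto simp: polys_le_def mon_deg_def)
qed

lemma polys_in_induct [consumes 1, case_names const var add mult]:
  assumes "p \<in> polys_in N"
    and "\<And>c. P (pconst c)" and "\<And>i. i \<in> N \<Longrightarrow> P (pvar i)"
    and "\<And>p q. P p \<Longrightarrow> P q \<Longrightarrow> P (p + q)" and "\<And>p q. P p \<Longrightarrow> P q \<Longrightarrow> P (p * q)"
  shows "P p"
proof -
  have 0: "P 0" and 1: "P 1" using assms(2)[of 0] assms(2)[of 1] by auto
  have sum: "P (sum f S)" if "\<And>i. i \<in> S \<Longrightarrow> P (f i)" for f :: "(nat \<Rightarrow>\<^sub>0 nat) \<Rightarrow> _" and S
    using that by (induction S rule: infinite_finite_induct) (auto intro: 0 assms(4))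
  have prod: "P (prod f S)" if "\<And>i. i \<in> S \<Longrightarrow> P (f i)" for f :: "nat \<Rightarrow> _" and S
    using that by (induction S rule: infinite_finite_induct) (auto intro: 1 assms(5))
  have power: "P (q ^ e)" if "P q" for q and e :: nat
    using that by (induction e) (auto intro: 1 assms(5))
  have "P (psubst pvar p)"
    unfolding psubst_def using assms(1)
    by (intro sum assms(5) assms(2) prod power assms(3)) (auto simp: polys_in_def)
  then show ?thesis by simp
qed

lemma psubst_cong:
  assumes "p \<in> polys_in N" "\<And>i. i \<in> N \<Longrightarrow> \<theta> i = \<eta> i"
  shows "psubst \<theta> p = psubst \<eta> p"
  using assms(1) by (induction rule: polys_in_induct) (auto simp: psubst_add psubst_mult assms(2))

lemma psubst_psubst: "psubst \<theta> (psubst \<eta> p) = psubst (\<lambda>i. psubst \<theta> (\<eta> i)) p"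
proof -
  have "p \<in> polys_in UNIV" by (simp add: polys_in_def)
  then show ?thesis by (induction rule: polys_in_induct) (auto simp: psubst_add psubst_mult)
qed


section \<open>Spans over subrings\<close>

text \<open>The closure properties that the span lemmas use. One predicate serves \<open>A\<close>,
  \<open>Inv\<close>, the constants, the invariant field, generated fields and the auxiliary set
  \<open>B\<close> of \<open>ex_inv_field_eq\<close>.\<close>

definition closed_semiring :: "'a::comm_ring_1 set \<Rightarrow> bool" where
  "closed_semiring R \<longleftrightarrow> 0 \<in> R \<and> 1 \<in> R \<and> (\<forall>x\<in>R. \<forall>y\<in>R. x + y \<in> R \<and> x * y \<in> R)"

lemma closed_semiringD:
  assumes "closed_semiring R"
  shows "0 \<in> R" "1 \<in> R" "x \<in> R \<Longrightarrow> y \<in> R \<Longrightarrow> x + y \<in> R" "x \<in> R \<Longrightarrow> y \<in> R \<Longrightarrow> x * y \<in> R"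
  using assms by (auto simp: closed_semiring_def)

lemma closed_semiring_sum:
  "closed_semiring R \<Longrightarrow> (\<And>i. i \<in> S \<Longrightarrow> f i \<in> R) \<Longrightarrow> sum f S \<in> R"
  by (induction S rule: infinite_finite_induct) (auto simp: closed_semiring_def)

lemma closed_semiring_prod:
  "closed_semiring R \<Longrightarrow> (\<And>i. i \<in> S \<Longrightarrow> f i \<in> R) \<Longrightarrow> prod f S \<in> R"
  by (induction S rule: infinite_finite_induct) (auto simp: closed_semiring_def)

lemma span_overI:
  "finite F \<Longrightarrow> F \<subseteq> S \<Longrightarrow> (\<And>s. s \<in> F \<Longrightarrow> a s \<in> R) \<Longrightarrow> (\<Sum>s\<in>F. a s * s) \<in> span_over R S"
  unfolding span_over_def by blast

lemma span_over_mono: "R \<subseteq> R' \<Longrightarrow> S \<subseteq> S' \<Longrightarrow> span_over R S \<subseteq> span_over R' S'"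
  unfolding span_over_def by blast

lemma span_over_0: "0 \<in> span_over R S"
  unfolding span_over_def by (force intro: exI[of _ "{}"])

lemma span_over_base:
  assumes "1 \<in> R" "s \<in> S"
  shows "s \<in> span_over R S"
  unfolding span_over_def using assms by (force intro!: exI[of _ "{s}"] exI[of _ "\<lambda>_. 1"])

lemma span_over_add:
  assumes R: "closed_semiring R" and x: "x \<in> span_over R S" and y: "y \<in> span_over R S"
  shows "x + y \<in> span_over R S"
proof -
  obtain F a where F: "finite F" "F \<subseteq> S" "\<And>s. s \<in> F \<Longrightarrow> a s \<in> R" "x = (\<Sum>s\<in>F. a s * s)"
    using x by (auto simp: span_over_def)
  obtain F' b where F': "finite F'" "F' \<subseteq> S" "\<And>s. s \<in> F' \<Longrightarrow> b s \<in> R" "y = (\<Sum>s\<in>F'. b s * s)"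
    using y by (auto simp: span_over_def)
  \<comment> \<open>Coefficients are extended by 0 to a common index set; on the overlap of
    \<open>F\<close> and \<open>F'\<close> they add up.\<close>
  let ?a = "\<lambda>s. if s \<in> F then a s else 0" and ?b = "\<lambda>s. if s \<in> F' then b s else 0"
  have "x = (\<Sum>s\<in>F \<union> F'. ?a s * s)" "y = (\<Sum>s\<in>F \<union> F'. ?b s * s)"
    unfolding F(4) F'(4) using F(1) F'(1) by (intro sum.mono_neutral_cong_left; auto)+
  then have "x + y = (\<Sum>s\<in>F \<union> F'. (?a s + ?b s) * s)"
    by (simp add: sum.distrib algebra_simps)
  moreover have "?a s + ?b s \<in> R" for s
    using F(3) F'(3) closed_semiringD[OF R] by auto
  ultimately show ?thesis
    using F(1,2) F'(1,2) span_overI[of "F \<union> F'" S "\<lambda>s. ?a s + ?b s" R] by simp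
qed

lemma span_over_scale:
  assumes R: "closed_semiring R" and r: "r \<in> R" and x: "x \<in> span_over R S"
  shows "r * x \<in> span_over R S"
proof -
  obtain F a where F: "finite F" "F \<subseteq> S" "\<And>s. s \<in> F \<Longrightarrow> a s \<in> R" "x = (\<Sum>s\<in>F. a s * s)"
    using x by (auto simp: span_over_def)
  have "r * x = (\<Sum>s\<in>F. (r * a s) * s)" by (simp add: F(4) sum_distrib_left mult.assoc)
  moreover have "r * a s \<in> R" if "s \<in> F" for s using F(3) r closed_semiringD(4)[OF R] that by auto
  ultimately show ?thesis using F(1,2) span_overI[of F S "\<lambda>s. r * a s" R] by simp
qed

lemma span_over_sum:
  "closed_semiring R \<Longrightarrow> (\<And>i. i \<in> I \<Longrightarrow> f i \<in> span_over R S) \<Longrightarrow> sum f I \<in> span_over R S"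
  by (induction I rule: infinite_finite_induct) (auto simp: span_over_0 span_over_add)

lemma span_over_induct [consumes 1, case_names zero add]:
  assumes "x \<in> span_over R S" and "P 0"
    and step: "\<And>r s x. r \<in> R \<Longrightarrow> s \<in> S \<Longrightarrow> P x \<Longrightarrow> P (r * s + x)"
  shows "P x"
proof -
  obtain F a where F: "finite F" "F \<subseteq> S" "\<And>s. s \<in> F \<Longrightarrow> a s \<in> R" and x: "x = (\<Sum>s\<in>F. a s * s)"
    using assms(1) by (auto simp: span_over_def)
  from F have "P (\<Sum>s\<in>F. a s * s)"
    by (induction F) (auto intro: assms(2) step)
  then show ?thesis by (simp add: x)
qed

lemma span_over_mult:
  assumes R: "closed_semiring R" and x: "x \<in> span_over R S" and y: "y \<in> span_over R S'"
    and T: "\<And>s s'. s \<in> S \<Longrightarrow> s' \<in> S' \<Longrightarrow> s * s' \<in> T"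
  shows "x * y \<in> span_over R T"
  using x
proof (induction rule: span_over_induct)
  case (add r s x)
  from y have "s * y \<in> span_over R T"
  proof (induction rule: span_over_induct)
    case (add r' s' y)
    have "s * (r' * s' + y) = r' * (s * s') + s * y" by (simp add: algebra_simps)
    then show ?case
      using add T[OF \<open>s \<in> S\<close>] closed_semiringD(2)[OF R]
      by (simp add: span_over_add[OF R] span_over_scale[OF R] span_over_base)
  qed (simp add: span_over_0)
  moreover have "(r * s + x) * y = r * (s * y) + x * y" by (simp add: algebra_simps)
  ultimately show ?case using add by (auto intro!: span_over_add[OF R] span_over_scale[OF R])
qed (simp add: span_over_0)

text \<open>\<open>S\<close> is a multiplicative filtration, so the degree bounds of the factors add
  up. It serves for powers of distinct variables and for factors that come from distinct
  summands.\<close>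

lemma span_over_prod:
  fixes S :: "nat \<Rightarrow> 'a::comm_ring_1 set" and d :: "'i \<Rightarrow> nat"
  assumes R: "closed_semiring R" and "finite J" and "\<And>j. j \<in> J \<Longrightarrow> x j \<in> span_over R (S (d j))"
    and "1 \<in> S 0" and T: "\<And>d d' s s'. s \<in> S d \<Longrightarrow> s' \<in> S d' \<Longrightarrow> s * s' \<in> S (d + d')"
  shows "prod x J \<in> span_over R (S (sum d J))"
  using assms(2,3)
proof induction
  case empty
  then show ?case using assms(4) by (simp add: span_over_base closed_semiringD(2)[OF R])
next
  case (insert j J)
  then have "x j \<in> span_over R (S (d j))" "prod x J \<in> span_over R (S (sum d J))" by auto
  from span_over_mult[OF R this T] show ?case using insert.hyps by simp
qed

lemma span_over_subset:
  assumes "closed_semiring R" "S \<subseteq> A" "0 \<in> A" "\<And>x y. x \<in> A \<Longrightarrow> y \<in> A \<Longrightarrow> x + y \<in> A"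
    "\<And>r x. r \<in> R \<Longrightarrow> x \<in> A \<Longrightarrow> r * x \<in> A"
  shows "span_over R S \<subseteq> A"
proof
  fix x assume "x \<in> span_over R S"
  then show "x \<in> A" by (induction rule: span_over_induct) (use assms in auto)
qed


section \<open>Independence of characters\<close>

text \<open>Taking the relation at \<open>a * b\<close> minus \<open>\<chi> h a\<close> times the
  relation at \<open>b\<close> eliminates \<open>h\<close> and leaves a shorter relation.
  Multiplicativity is asked on \<open>A\<close> alone, because the polynomials in the coordinates of
  \<open>V\<close> are a proper subset of their type.\<close>

lemma dedekind_independence:
  fixes \<chi> :: "'g \<Rightarrow> 'a::comm_ring_1 \<Rightarrow> 'b::idom"
  assumes "finite S" and A: "closed_semiring A"
    and one: "\<And>g. g \<in> S \<Longrightarrow> \<chi> g 1 = 1"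
    and mult: "\<And>g a b. g \<in> S \<Longrightarrow> a \<in> A \<Longrightarrow> b \<in> A \<Longrightarrow> \<chi> g (a * b) = \<chi> g a * \<chi> g b"
    and dist: "\<And>g h. g \<in> S \<Longrightarrow> h \<in> S \<Longrightarrow> g \<noteq> h \<Longrightarrow> \<exists>a\<in>A. \<chi> g a \<noteq> \<chi> h a"
    and zero: "\<And>a. a \<in> A \<Longrightarrow> (\<Sum>g\<in>S. c g * \<chi> g a) = 0"
    and "g \<in> S"
  shows "c g = 0"
  using assms(1,3-)
proof (induction S arbitrary: c g rule: finite_induct)
  case (insert h S)
  have "c g = 0" if g: "g \<in> S" for g
  proof -
    have "g \<noteq> h" using g insert.hyps by auto
    then obtain a where a: "a \<in> A" "\<chi> g a \<noteq> \<chi> h a" using insert.prems(3)[of g h] g by auto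
    have "(\<Sum>g\<in>S. (c g * (\<chi> g a - \<chi> h a)) * \<chi> g b) = 0" if b: "b \<in> A" for b
    proof -
      \<comment> \<open>The added term for \<open>h\<close> carries the factor
        \<open>\<chi> h a - \<chi> h a\<close>.\<close>
      have "(\<Sum>g\<in>S. (c g * (\<chi> g a - \<chi> h a)) * \<chi> g b)
          = (\<Sum>g\<in>insert h S. (c g * (\<chi> g a - \<chi> h a)) * \<chi> g b)"
        using insert.hyps by simp
      also have "\<dots> = (\<Sum>g\<in>insert h S. c g * \<chi> g (a * b) - \<chi> h a * (c g * \<chi> g b))"
        using insert.prems(2) a(1) b by (intro sum.cong refl) (simp add: algebra_simps)
      also have "\<dots> = (\<Sum>g\<in>insert h S. c g * \<chi> g (a * b)) - \<chi> h a * (\<Sum>g\<in>insert h S. c g * \<chi> g b)"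
        by (simp add: sum_subtractf sum_distrib_left)
      also have "\<dots> = 0"
        using insert.prems(4) a(1) b closed_semiringD(4)[OF A] by simp
      finally show ?thesis .
    qed
    then have "c g * (\<chi> g a - \<chi> h a) = 0"
      by (intro insert.IH[OF _ _ _ _ g, of "\<lambda>g. c g * (\<chi> g a - \<chi> h a)"])
        (simp_all add: insert.prems(1-3))
    with a(2) show ?thesis by simp
  qed
  \<comment> \<open>With the other coefficients gone, the relation at 1 leaves only
    \<open>c h\<close>.\<close>
  moreover have "c h = 0"
    using insert.prems(4)[OF closed_semiringD(2)[OF A]] calculation insert.hyps insert.prems(1)[of h] by simp
  ultimately show ?case using insert.prems(5) by auto
qed simp


section \<open>Linear maps on coordinate functions\<close>

definition is_basis :: "('k::field \<Rightarrow> 'v::ab_group_add \<Rightarrow> 'v) \<Rightarrow> 'v list \<Rightarrow> 'v set \<Rightarrow> bool" where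
  "is_basis scale bs V \<longleftrightarrow>
     distinct bs \<and> \<not> module.dependent scale (set bs) \<and> module.span scale (set bs) = V"

text \<open>The pullback of the \<open>i\<close>-th coordinate function along \<open>L\<close>.\<close>

definition pull ::
    "('k::field \<Rightarrow> 'v::ab_group_add \<Rightarrow> 'v) \<Rightarrow> 'v list \<Rightarrow> 'v list \<Rightarrow> ('v \<Rightarrow> 'v) \<Rightarrow> nat \<Rightarrow> 'k mpoly" where
  "pull scale bs bs' L i =
     (\<Sum>j<length bs. pconst (module.representation scale (set bs') (L (bs ! j)) (bs' ! i)) * pvar j)"

lemma poly_act_eq:
  "poly_act scale G V \<rho> g =
     psubst (pull scale (basis_of scale V) (basis_of scale V) (\<rho> (inv\<^bsub>G\<^esub> g)))"
  by (simp add: poly_act_def Let_def pull_def [abs_def])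

lemma pull_in: "pull scale bs bs' L i \<in> polys_in {..<length bs}"
  unfolding pull_def by (intro polys_in_sum polys_in_mult polys_in_pconst polys_in_pvar) auto

lemma pull_le: "pull scale bs bs' L i \<in> polys_le 1"
  unfolding pull_def
proof (rule polys_le_sum)
  fix j
  show "pconst (module.representation scale (set bs') (L (bs ! j)) (bs' ! i)) * pvar j \<in> polys_le 1"
    using polys_le_mult[OF polys_le_pconst[of _ 0] polys_le_pvar[of 1]] by simp
qed

lemma pull_cong:
  "(\<And>v. v \<in> set bs \<Longrightarrow> L v = L' v) \<Longrightarrow> pull scale bs bs' L i = pull scale bs bs' L' i"
  by (simp add: pull_def)

text \<open>Linearity is confined to \<open>V\<close> because the elements of
  \<open>GL scale V\<close> are \<open>undefined\<close> outside it.\<close>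

definition linear_map_on :: "('k::field \<Rightarrow> 'v::ab_group_add \<Rightarrow> 'v) \<Rightarrow> 'v set \<Rightarrow> ('v \<Rightarrow> 'v) \<Rightarrow> bool" where
  "linear_map_on scale V L \<longleftrightarrow>
     (\<forall>x\<in>V. \<forall>y\<in>V. L (x + y) = L x + L y) \<and> (\<forall>c. \<forall>x\<in>V. L (scale c x) = scale c (L x))"

context vector_space
begin

lemma is_basisD:
  assumes "is_basis scale bs V"
  shows "distinct bs" "independent (set bs)" "span (set bs) = V"
  using assms by (auto simp: is_basis_def)

lemma is_basis_expand:
  assumes "is_basis scale bs V" "v \<in> V"
  shows "(\<Sum>l<length bs. scale (representation (set bs) v (bs ! l)) (bs ! l)) = v"
proof -
  note bs = is_basisD[OF assms(1)]
  have "(\<Sum>l<length bs. scale (representation (set bs) v (bs ! l)) (bs ! l))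
      = (\<Sum>b\<in>set bs. scale (representation (set bs) v b) b)"
    by (rule sum.reindex_bij_betw[OF bij_betw_nth[OF bs(1) refl refl]])
  also have "\<dots> = v"
    using bs assms(2) by (intro sum_representation_eq) auto
  finally show ?thesis .
qed

lemma linear_map_on_sum:
  assumes L: "linear_map_on scale V L" and V: "subspace V" and "\<And>i. i \<in> S \<Longrightarrow> x i \<in> V"
  shows "L (sum x S) = (\<Sum>i\<in>S. L (x i))"
proof -
  have 0: "L 0 = 0"
    using L subspace_0[OF V] unfolding linear_map_on_def by (metis scale_zero_left)
  show ?thesis
    using assms(3)
  proof (induction S rule: infinite_finite_induct)
    case (insert i S)
    then have "x i \<in> V" "sum x S \<in> V" using V by (auto intro: subspace_sum)
    with insert L show ?case by (simp add: linear_map_on_def)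
  qed (auto simp: 0)
qed

lemma subspace_of_basis: "is_basis scale bs V \<Longrightarrow> subspace V"
  using is_basisD(3) by blast

text \<open>The matrix of \<open>L\<close> applied to the coordinate vector of
  \<open>v\<close>.\<close>

lemma representation_linear_map:
  assumes bs: "is_basis scale bs V" and bs': "is_basis scale bs' V'"
    and L: "linear_map_on scale V L" "L ` V \<subseteq> V'" and v: "v \<in> V"
  shows "representation (set bs') (L v) c =
    (\<Sum>l<length bs. representation (set bs) v (bs ! l) * representation (set bs') (L (bs ! l)) c)"
proof -
  have bsV: "bs ! l \<in> V" if "l < length bs" for l
    using is_basisD(3)[OF bs] that span_base[of "bs ! l" "set bs"] by auto
  have sc: "scale a x \<in> V" if "x \<in> V" for a x
    using subspace_scale[OF subspace_of_basis[OF bs]] that .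
  have sp: "L x \<in> span (set bs')" if "x \<in> V" for x
    using L(2) that is_basisD(3)[OF bs'] by auto
  let ?r = "\<lambda>l. representation (set bs) v (bs ! l)"
  have "L v = L (\<Sum>l<length bs. scale (?r l) (bs ! l))"
    by (simp add: is_basis_expand[OF bs v])
  also have "\<dots> = (\<Sum>l<length bs. L (scale (?r l) (bs ! l)))"
    by (intro linear_map_on_sum[OF L(1) subspace_of_basis[OF bs]]) (auto intro: sc bsV)
  also have "\<dots> = (\<Sum>l<length bs. scale (?r l) (L (bs ! l)))"
    using L(1) bsV by (intro sum.cong refl) (auto simp: linear_map_on_def)
  finally have "representation (set bs') (L v)
      = (\<lambda>c. \<Sum>l<length bs. representation (set bs') (scale (?r l) (L (bs ! l))) c)"
    using representation_sum[OF is_basisD(2)[OF bs'], of "{..<length bs}" "\<lambda>l. scale (?r l) (L (bs ! l))"]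
      sp bsV by (simp add: span_scale)
  then show ?thesis
    using is_basisD(2)[OF bs'] sp bsV by (simp add: representation_scale)
qed

text \<open>Contravariance of pullback, by multiplication of matrices. \<open>act_act\<close>,
  \<open>cores_ext\<close>, \<open>act_ext\<close> and \<open>sum_ext_cores\<close> are all obtained
  from it.\<close>

lemma psubst_pull_pull:
  assumes bs': "is_basis scale bs' V'" and bs'': "is_basis scale bs'' V''"
    and L1: "\<And>b. b \<in> set bs \<Longrightarrow> L1 b \<in> V'" and L2: "linear_map_on scale V' L2" "L2 ` V' \<subseteq> V''"
  shows "psubst (pull scale bs bs' L1) (pull scale bs' bs'' L2 i) = pull scale bs bs'' (L2 \<circ> L1) i"
proof -
  let ?r' = "representation (set bs')" and ?r'' = "representation (set bs'')"
  have "psubst (pull scale bs bs' L1) (pull scale bs' bs'' L2 i)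
    = (\<Sum>l<length bs'. \<Sum>j<length bs. pconst (?r' (L1 (bs ! j)) (bs' ! l) * ?r'' (L2 (bs' ! l)) (bs'' ! i)) * pvar j)"
    by (simp add: pull_def psubst_sum psubst_mult pconst_mult sum_distrib_left mult_ac)
  also have "\<dots> = (\<Sum>j<length bs. \<Sum>l<length bs'. pconst (?r' (L1 (bs ! j)) (bs' ! l) * ?r'' (L2 (bs' ! l)) (bs'' ! i)) * pvar j)"
    by (rule sum.swap)
  also have "\<dots> = pull scale bs bs'' (L2 \<circ> L1) i"
    unfolding pull_def comp_def using L1
    by (intro sum.cong refl)
      (simp add: representation_linear_map[OF bs' bs'' L2] pconst_sum sum_distrib_right)
  finally show ?thesis .
qed

lemma pull_id:
  assumes bs: "is_basis scale bs V" and i: "i < length bs" and L: "\<And>b. b \<in> set bs \<Longrightarrow> L b = b"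
  shows "pull scale bs bs L i = pvar i"
proof -
  have "pull scale bs bs L i = (\<Sum>j<length bs. if j = i then pvar j else 0)"
    unfolding pull_def using i is_basisD[OF bs]
    by (intro sum.cong refl) (auto simp: L representation_basis nth_eq_iff_index_eq)
  then show ?thesis using i by simp
qed

text \<open>Turns the decomposition of a vector into its components into a decomposition of the
  coordinate functions.\<close>

lemma pull_sum:
  assumes "is_basis scale bs' V'" "\<And>j b. j \<in> J \<Longrightarrow> b \<in> set bs \<Longrightarrow> L j b \<in> V'"
  shows "(\<Sum>j\<in>J. pull scale bs bs' (L j) i) = pull scale bs bs' (\<lambda>v. \<Sum>j\<in>J. L j v) i"
proof -
  note bs' = is_basisD[OF assms(1)]
  have "(\<Sum>j\<in>J. pull scale bs bs' (L j) i)
    = (\<Sum>l<length bs. \<Sum>j\<in>J. pconst (representation (set bs') (L j (bs ! l)) (bs' ! i)) * pvar l)"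
    unfolding pull_def by (rule sum.swap)
  also have "\<dots> = pull scale bs bs' (\<lambda>v. \<Sum>j\<in>J. L j v) i"
    unfolding pull_def using assms(2) bs'
    by (intro sum.cong refl) (simp add: representation_sum pconst_sum sum_distrib_right)
  finally show ?thesis .
qed

text \<open>The coefficient of the variable \<open>j\<close> in the pullback of coordinate
  \<open>i\<close> is a matrix entry, so the substitution determines the linear map. Faithfulness
  passes from vectors to polynomials in this way.\<close>

lemma pull_inject:
  assumes bs: "is_basis scale bs V" and bs': "is_basis scale bs' V'"
    and L: "linear_map_on scale V L" "L ` V \<subseteq> V'" and M: "linear_map_on scale V M" "M ` V \<subseteq> V'"
    and eq: "\<And>i. i < length bs' \<Longrightarrow> pull scale bs bs' L i = pull scale bs bs' M i" and v: "v \<in> V"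
  shows "L v = M v"
proof -
  have single_eq: "Poly_Mapping.single i (Suc 0) = Poly_Mapping.single j (Suc 0) \<longleftrightarrow> i = j" for i j :: nat
    by (metis keys_single singleton_inject nat.distinct(1))
  have lookup: "Poly_Mapping.lookup (pull scale bs bs' N i) (Poly_Mapping.single j 1)
      = representation (set bs') (N (bs ! j)) (bs' ! i)" if "j < length bs" for N i j
  proof -
    have "Poly_Mapping.lookup (pull scale bs bs' N i) (Poly_Mapping.single j 1)
      = (\<Sum>l<length bs. if l = j then representation (set bs') (N (bs ! l)) (bs' ! i) else 0)"
      unfolding pull_def lookup_sum
      by (intro sum.cong refl)
        (simp add: pconst_def pvar_def mult_single lookup_single when_def single_eq)
    then show ?thesis using that by simp
  qed
  have bsV: "bs ! l \<in> V" if "l < length bs" for l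
    using is_basisD(3)[OF bs] that span_base[of "bs ! l" "set bs"] by auto
  have "L (bs ! j) = M (bs ! j)" if j: "j < length bs" for j
  proof -
    have "representation (set bs') (L (bs ! j)) (bs' ! i) = representation (set bs') (M (bs ! j)) (bs' ! i)"
      if "i < length bs'" for i
      using lookup[OF j, of L i] lookup[OF j, of M i] eq[OF that] by simp
    then have "(\<Sum>i<length bs'. scale (representation (set bs') (L (bs ! j)) (bs' ! i)) (bs' ! i)) =
        (\<Sum>i<length bs'. scale (representation (set bs') (M (bs ! j)) (bs' ! i)) (bs' ! i))"
      by (intro sum.cong refl) simp
    moreover have "L (bs ! j) \<in> V'" "M (bs ! j) \<in> V'" using L(2) M(2) bsV[OF j] by auto
    ultimately show ?thesis
      by (simp only: is_basis_expand[OF bs'])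
  qed
  then have eq: "(\<Sum>l<length bs. scale (representation (set bs) v (bs ! l)) (L (bs ! l)))
      = (\<Sum>l<length bs. scale (representation (set bs) v (bs ! l)) (M (bs ! l)))" by simp
  have expand: "N v = (\<Sum>l<length bs. scale (representation (set bs) v (bs ! l)) (N (bs ! l)))"
    if N: "linear_map_on scale V N" for N
  proof -
    have sc: "scale a x \<in> V" if "x \<in> V" for a x
      using subspace_scale[OF subspace_of_basis[OF bs]] that .
    have "N v = N (\<Sum>l<length bs. scale (representation (set bs) v (bs ! l)) (bs ! l))"
      by (simp add: is_basis_expand[OF bs v])
    also have "\<dots> = (\<Sum>l<length bs. N (scale (representation (set bs) v (bs ! l)) (bs ! l)))"
      by (intro linear_map_on_sum[OF N subspace_of_basis[OF bs]]) (auto intro: sc bsV)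
    also have "\<dots> = (\<Sum>l<length bs. scale (representation (set bs) v (bs ! l)) (N (bs ! l)))"
      using N bsV by (intro sum.cong refl) (auto simp: linear_map_on_def)
    finally show ?thesis .
  qed
  show ?thesis using expand[OF L(1)] expand[OF M(1)] eq by (simp only:)
qed

text \<open>The finite spanning set of the ambient \<open>U\<close> bounds every independent subset
  of \<open>V\<close>. This makes the choice in \<open>basis_of\<close> meaningful for
  subrepresentations too.\<close>

lemma is_basis_basis_of:
  assumes V: "subspace V" and "V \<subseteq> U" and U: "findim_space scale U"
  shows "is_basis scale (basis_of scale V) V"
proof -
  obtain B where B: "B \<subseteq> V" "independent B" "V \<subseteq> span B"
    using maximal_independent_subset by blast
  obtain C where "finite C" "span C = U" using U by (auto simp: findim_space_def)
  then have "finite B"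
    using independent_span_bound[of C B] B assms(2) by auto
  then obtain bs where bs: "set bs = B" "distinct bs" using finite_distinct_list by blast
  have "span B = V" using B V by (simp add: span_minimal subset_antisym)
  then have "distinct bs \<and> independent (set bs) \<and> span (set bs) = V" using bs B by simp
  then show ?thesis unfolding is_basis_def basis_of_def by (rule someI)
qed

end


section \<open>Group actions on polynomials and their invariants\<close>

text \<open>Instantiated by \<open>G\<close> on \<open>V\<close> and also by each image group acting
  tautologically on its summand.\<close>

locale faithful_rep = G: group G + vector_space scale
  for G :: "('g, 'm) monoid_scheme"
    and scale :: "'k::field \<Rightarrow> 'v::ab_group_add \<Rightarrow> 'v" +
  fixes V :: "'v set" and \<rho> :: "'g \<Rightarrow> 'v \<Rightarrow> 'v"
  assumes finite_G: "finite (carrier G)"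
    and findim: "findim_space scale V"
    and linear_rep: "linear_rep scale G V \<rho>"
    and inj: "inj_on \<rho> (carrier G)"
begin

abbreviation "dm \<equiv> length (basis_of scale V)"
abbreviation "A \<equiv> poly_ring scale V"
abbreviation "Ale \<equiv> poly_ring_le scale V"
abbreviation "act \<equiv> poly_act scale G V \<rho>"
abbreviation "Inv \<equiv> poly_inv scale G V \<rho>"

lemma poly_ring_eq: "A = polys_in {..<dm}"
  by (simp add: poly_ring_def polys_in_def)

lemma poly_ring_le_eq: "Ale d = A \<inter> polys_le d"
  by (auto simp: poly_ring_le_def polys_le_def mon_deg_def)

lemma rho_mem: "g \<in> carrier G \<Longrightarrow> \<rho> g \<in> carrier (GL scale V)"
  using linear_rep by (auto simp: linear_rep_def hom_def)

lemma rho_Bij: "g \<in> carrier G \<Longrightarrow> \<rho> g \<in> Bij V"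
  and rho_linear: "g \<in> carrier G \<Longrightarrow> linear_map_on scale V (\<rho> g)"
  using rho_mem by (auto simp: GL_def linear_map_on_def)

lemma rho_closed: "g \<in> carrier G \<Longrightarrow> v \<in> V \<Longrightarrow> \<rho> g v \<in> V"
  using Bij_imp_funcset[OF rho_Bij] by auto

lemma rho_mult:
  assumes "g \<in> carrier G" "h \<in> carrier G" "v \<in> V"
  shows "\<rho> (g \<otimes>\<^bsub>G\<^esub> h) v = \<rho> g (\<rho> h v)"
proof -
  have "\<rho> (g \<otimes>\<^bsub>G\<^esub> h) = \<rho> g \<otimes>\<^bsub>GL scale V\<^esub> \<rho> h"
    using linear_rep assms by (simp add: linear_rep_def hom_def)
  then show ?thesis
    using rho_Bij assms by (simp add: GL_def BijGroup_def compose_def)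
qed

text \<open>The homomorphism law makes the map idempotent, and an injective idempotent map is the
  identity.\<close>

lemma rho_one:
  assumes "v \<in> V"
  shows "\<rho> \<one>\<^bsub>G\<^esub> v = v"
proof -
  have "\<rho> \<one>\<^bsub>G\<^esub> (\<rho> \<one>\<^bsub>G\<^esub> v) = \<rho> \<one>\<^bsub>G\<^esub> v" using rho_mult[of "\<one>\<^bsub>G\<^esub>" "\<one>\<^bsub>G\<^esub>" v] assms by simp
  moreover have "inj_on (\<rho> \<one>\<^bsub>G\<^esub>) V" using rho_Bij[OF G.one_closed] by (simp add: Bij_def bij_betw_def)
  ultimately show ?thesis using assms rho_closed[OF G.one_closed] by (meson inj_onD)
qed

lemma subspace_V: "subspace V"
  using findim by (auto simp: findim_space_def)

lemma basis: "is_basis scale (basis_of scale V) V"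
  by (rule is_basis_basis_of[OF subspace_V subset_refl findim])

lemma basis_in: "b \<in> set (basis_of scale V) \<Longrightarrow> b \<in> V"
  using is_basisD(3)[OF basis] span_base by auto

lemma act_add: "act g (p + q) = act g p + act g q"
  and act_mult: "act g (p * q) = act g p * act g q"
  and act_uminus: "act g (- p) = - act g p"
  and act_0 [simp]: "act g 0 = 0"
  and act_1 [simp]: "act g 1 = 1"
  and act_pconst [simp]: "act g (pconst c) = pconst c"
  and act_sum: "act g (sum f S) = (\<Sum>i\<in>S. act g (f i))"
  and act_prod: "act g (prod f' S') = (\<Prod>i\<in>S'. act g (f' i))"
  by (simp_all add: poly_act_eq psubst_add psubst_mult psubst_uminus psubst_sum psubst_prod)

lemma A_add: "p \<in> A \<Longrightarrow> q \<in> A \<Longrightarrow> p + q \<in> A"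
  and A_mult: "p \<in> A \<Longrightarrow> q \<in> A \<Longrightarrow> p * q \<in> A"
  and A_uminus: "p \<in> A \<Longrightarrow> - p \<in> A"
  and A_pconst: "pconst c \<in> A"
  and A_0: "0 \<in> A"
  and A_1: "1 \<in> A"
  by (simp_all add: poly_ring_eq polys_in_add polys_in_mult polys_in_uminus)

lemma closed_semiring_A: "closed_semiring A"
  by (simp add: closed_semiring_def A_add A_mult A_0 A_1)

lemma act_in: "p \<in> A \<Longrightarrow> act g p \<in> A"
  unfolding poly_ring_eq poly_act_eq by (rule psubst_in[OF _ pull_in])

lemma act_le: "p \<in> Ale d \<Longrightarrow> act g p \<in> Ale d"
  using act_in by (auto simp: poly_ring_le_eq poly_act_eq psubst_le[OF _ pull_le])

text \<open>The inverse in \<open>poly_act\<close> undoes the order reversal of pullback, which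
  gives a left action.\<close>

lemma act_act:
  assumes g: "g \<in> carrier G" and h: "h \<in> carrier G"
  shows "act g (act h p) = act (g \<otimes>\<^bsub>G\<^esub> h) p"
proof -
  let ?pull = "pull scale (basis_of scale V) (basis_of scale V)"
  have "psubst (?pull (\<rho> (inv\<^bsub>G\<^esub> g))) (?pull (\<rho> (inv\<^bsub>G\<^esub> h)) i) = ?pull (\<rho> (inv\<^bsub>G\<^esub> (g \<otimes>\<^bsub>G\<^esub> h))) i" for i
  proof -
    have "psubst (?pull (\<rho> (inv\<^bsub>G\<^esub> g))) (?pull (\<rho> (inv\<^bsub>G\<^esub> h)) i) = ?pull (\<rho> (inv\<^bsub>G\<^esub> h) \<circ> \<rho> (inv\<^bsub>G\<^esub> g)) i"
      using g h by (intro psubst_pull_pull[OF basis basis]) (auto intro: rho_closed basis_in rho_linear)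
    also have "\<dots> = ?pull (\<rho> (inv\<^bsub>G\<^esub> (g \<otimes>\<^bsub>G\<^esub> h))) i"
      using g h by (intro pull_cong) (simp add: G.inv_mult_group rho_mult basis_in)
    finally show ?thesis .
  qed
  then show ?thesis by (simp add: poly_act_eq psubst_psubst)
qed

text \<open>Restricted to \<open>A\<close> because only the variables with index below
  \<open>dm\<close> are coordinate functions of \<open>V\<close>.\<close>

lemma act_one:
  assumes "p \<in> A"
  shows "act \<one>\<^bsub>G\<^esub> p = p"
proof -
  have "act \<one>\<^bsub>G\<^esub> p = psubst pvar p"
    using assms unfolding poly_act_eq poly_ring_eq
    by (rule psubst_cong) (auto intro!: pull_id[OF basis] simp: rho_one basis_in)
  then show ?thesis by simp
qed

lemma act_eq_0_iff:
  assumes "g \<in> carrier G" "p \<in> A"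
  shows "act g p = 0 \<longleftrightarrow> p = 0"
proof
  assume "act g p = 0"
  then have "act (inv\<^bsub>G\<^esub> g) (act g p) = 0" by simp
  then show "p = 0" using assms by (simp add: act_act act_one)
qed simp

text \<open>Elements that agree on the variables have inverses with equal matrices. This is the
  distinctness hypothesis of Dedekind's theorem.\<close>

lemma act_distinct:
  assumes "g \<in> carrier G" "h \<in> carrier G" "g \<noteq> h"
  shows "\<exists>p\<in>A. act g p \<noteq> act h p"
proof (rule ccontr)
  assume *: "\<not> ?thesis"
  let ?pull = "pull scale (basis_of scale V) (basis_of scale V)"
  have "?pull (\<rho> (inv\<^bsub>G\<^esub> g)) i = ?pull (\<rho> (inv\<^bsub>G\<^esub> h)) i" if "i < dm" for i
    using * polys_in_pvar[of i "{..<dm}"] that by (force simp: poly_ring_eq poly_act_eq)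
  then have "\<rho> (inv\<^bsub>G\<^esub> g) v = \<rho> (inv\<^bsub>G\<^esub> h) v" if "v \<in> V" for v
    using that assms by (intro pull_inject[OF basis basis]) (auto intro: rho_linear rho_closed)
  then have "\<rho> (inv\<^bsub>G\<^esub> g) = \<rho> (inv\<^bsub>G\<^esub> h)"
    using assms rho_Bij by (intro extensionalityI[of _ V]) (auto intro: Bij_imp_extensional)
  then have "inv\<^bsub>G\<^esub> g = inv\<^bsub>G\<^esub> h" using inj assms by (auto dest: inj_onD)
  then show False using assms by (metis G.inv_inv)
qed

section \<open>Invariants, traces and norms\<close>

lemma bij_lmult: "h \<in> carrier G \<Longrightarrow> bij_betw (\<lambda>g. h \<otimes>\<^bsub>G\<^esub> g) (carrier G) (carrier G)"
  by (rule bij_betwI[where g = "\<lambda>g. inv\<^bsub>G\<^esub> h \<otimes>\<^bsub>G\<^esub> g"]) (auto simp: G.m_assoc[symmetric])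

lemma Inv_iff: "p \<in> Inv \<longleftrightarrow> p \<in> A \<and> (\<forall>g\<in>carrier G. act g p = p)"
  by (auto simp: poly_inv_def)

lemma Inv_pconst: "pconst c \<in> Inv"
  by (simp add: Inv_iff A_pconst)

lemma closed_semiring_Inv: "closed_semiring Inv"
  by (auto simp: closed_semiring_def Inv_iff A_add A_mult act_add act_mult A_0 A_1)

lemma Inv_uminus: "p \<in> Inv \<Longrightarrow> - p \<in> Inv"
  by (auto simp: Inv_iff A_uminus act_uminus)

definition Tr :: "'k mpoly \<Rightarrow> 'k mpoly" where
  "Tr p = (\<Sum>g\<in>carrier G. act g p)"

text \<open>The norm supplies a nonzero invariant multiple of any nonzero polynomial, which is how
  denominators are made invariant.\<close>

definition Nm :: "'k mpoly \<Rightarrow> 'k mpoly" where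
  "Nm p = (\<Prod>g\<in>carrier G. act g p)"

lemma Tr_Inv: "p \<in> A \<Longrightarrow> Tr p \<in> Inv"
  unfolding Inv_iff
proof (intro conjI ballI)
  assume p: "p \<in> A"
  show "Tr p \<in> A" unfolding Tr_def using p by (intro closed_semiring_sum[OF closed_semiring_A] act_in)
  fix h assume h: "h \<in> carrier G"
  have "act h (Tr p) = (\<Sum>g\<in>carrier G. act (h \<otimes>\<^bsub>G\<^esub> g) p)"
    using h by (simp add: Tr_def act_sum act_act)
  also have "\<dots> = Tr p" unfolding Tr_def by (rule sum.reindex_bij_betw[OF bij_lmult[OF h]])
  finally show "act h (Tr p) = Tr p" .
qed

lemma Nm_Inv: "p \<in> A \<Longrightarrow> Nm p \<in> Inv"
  unfolding Inv_iff
proof (intro conjI ballI)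
  assume p: "p \<in> A"
  show "Nm p \<in> A" unfolding Nm_def using p by (intro closed_semiring_prod[OF closed_semiring_A] act_in)
  fix h assume h: "h \<in> carrier G"
  have "act h (Nm p) = (\<Prod>g\<in>carrier G. act (h \<otimes>\<^bsub>G\<^esub> g) p)"
    using h by (simp add: Nm_def act_prod act_act)
  also have "\<dots> = Nm p" unfolding Nm_def by (rule prod.reindex_bij_betw[OF bij_lmult[OF h]])
  finally show "act h (Nm p) = Nm p" .
qed

lemma Nm_nonzero: "p \<in> A \<Longrightarrow> p \<noteq> 0 \<Longrightarrow> Nm p \<noteq> 0"
  by (simp add: Nm_def finite_G act_eq_0_iff)

text \<open>The factor of the identity element is \<open>p\<close> itself; the other factors form
  the cofactor.\<close>

lemma Nm_multiple:
  assumes "p \<in> A"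
  obtains p' where "p' \<in> A" "Nm p = p' * p"
proof
  show "(\<Prod>g\<in>carrier G - {\<one>\<^bsub>G\<^esub>}. act g p) \<in> A"
    using assms by (intro closed_semiring_prod[OF closed_semiring_A] act_in)
  show "Nm p = (\<Prod>g\<in>carrier G - {\<one>\<^bsub>G\<^esub>}. act g p) * p"
    unfolding Nm_def using prod.remove[OF finite_G G.one_closed, of "\<lambda>g. act g p"] assms
    by (simp add: act_one mult.commute)
qed

lemma Tr_add: "Tr (p + q) = Tr p + Tr q"
  by (simp add: Tr_def act_add sum.distrib)

lemma Tr_0 [simp]: "Tr 0 = 0"
  by (simp add: Tr_def)

lemma Tr_mult_Inv: "a \<in> Inv \<Longrightarrow> Tr (a * p) = a * Tr p"
  by (simp add: Tr_def act_mult Inv_iff sum_distrib_left)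

lemma Tr_le: "p \<in> Ale d \<Longrightarrow> Tr p \<in> Ale d"
  using act_le[of p d]
  by (auto simp: Tr_def poly_ring_le_eq intro!: closed_semiring_sum[OF closed_semiring_A] polys_le_sum)

text \<open>A trace that vanishes on \<open>A\<close> would be a linear relation among distinct
  characters with all coefficients 1.\<close>

lemma ex_Tr_nonzero: "\<exists>e\<in>A. Tr e \<noteq> 0"
proof (rule ccontr)
  assume "\<not> ?thesis"
  then have "(\<Sum>g\<in>carrier G. 1 * act g p) = 0" if "p \<in> A" for p
    using that by (simp add: Tr_def)
  then have "(1 :: 'k mpoly) = 0"
    by (intro dedekind_independence[where \<chi> = act and S = "carrier G" and A = A and g = "\<one>\<^bsub>G\<^esub>" and c = "\<lambda>_. 1"])
      (auto simp: finite_G closed_semiring_A act_mult act_distinct)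
  then show False by simp
qed

text \<open>Discharges the definite description: two representations of a fraction are compared by
  cross multiplication, and injectivity of the action keeps denominators nonzero.\<close>

lemma frac_act_Fract:
  assumes g: "g \<in> carrier G" and "p \<in> A" "q \<in> A" "q \<noteq> 0"
  shows "frac_act scale G V \<rho> g (Fract p q) = Fract (act g p) (act g q)"
  unfolding frac_act_def
proof (rule the_equality)
  show "\<exists>p'\<in>A. \<exists>q'\<in>A. q' \<noteq> 0 \<and> Fract p q = Fract p' q' \<and>
      Fract (act g p) (act g q) = Fract (act g p') (act g q')"
    using assms by blast
next
  fix y assume "\<exists>p'\<in>A. \<exists>q'\<in>A. q' \<noteq> 0 \<and> Fract p q = Fract p' q' \<and> y = Fract (act g p') (act g q')"
  then obtain p' q' where *: "p' \<in> A" "q' \<in> A" "q' \<noteq> 0" "Fract p q = Fract p' q'"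
    "y = Fract (act g p') (act g q')" by blast
  then have "p * q' = p' * q" using assms by (simp add: eq_fract)
  then have "act g p * act g q' = act g p' * act g q" by (metis act_mult)
  then show "y = Fract (act g p) (act g q)"
    using * assms by (simp add: eq_fract act_eq_0_iff)
qed

text \<open>Expanding a fraction until its denominator is a norm makes the denominator invariant;
  invariance of the fraction then forces that of the numerator.\<close>

lemma frac_inv_eq: "frac_inv scale G V \<rho> = {Fract p q | p q. p \<in> Inv \<and> q \<in> Inv \<and> q \<noteq> 0}"
proof (intro equalityI subsetI)
  fix x assume "x \<in> frac_inv scale G V \<rho>"
  then obtain p q where x: "x = Fract p q" "p \<in> A" "q \<in> A" "q \<noteq> 0"
    and inv: "\<And>g. g \<in> carrier G \<Longrightarrow> frac_act scale G V \<rho> g x = x"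
    by (auto simp: frac_inv_def frac_field_def)
  obtain q' where q': "q' \<in> A" "Nm q = q' * q" using Nm_multiple x(3) by blast
  have N: "Nm q \<in> Inv" "Nm q \<noteq> 0" using Nm_Inv Nm_nonzero x by auto
  have "q' \<noteq> 0" using q' N by auto
  then have x': "x = Fract (q' * p) (Nm q)" using q' x(4) by (simp add: x(1) eq_fract mult_ac)
  have "q' * p \<in> Inv"
    unfolding Inv_iff
  proof (intro conjI ballI)
    show A: "q' * p \<in> A" using q' x by (simp add: A_mult)
    fix g assume g: "g \<in> carrier G"
    have "Fract (act g (q' * p)) (Nm q) = Fract (q' * p) (Nm q)"
      using frac_act_Fract[OF g A, of "Nm q"] N inv[OF g] g by (simp add: x' Inv_iff)
    then show "act g (q' * p) = q' * p" using N by (simp add: eq_fract)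
  qed
  with x' N show "x \<in> {Fract p q | p q. p \<in> Inv \<and> q \<in> Inv \<and> q \<noteq> 0}" by blast
next
  fix x assume "x \<in> {Fract p q | p q. p \<in> Inv \<and> q \<in> Inv \<and> q \<noteq> 0}"
  then show "x \<in> frac_inv scale G V \<rho>"
    by (auto simp: frac_inv_def frac_field_def Inv_iff frac_act_Fract) 
qed

end


section \<open>Generated subfields of a field type\<close>

lemma ring_of_type_algebra_simps:
  "carrier ring_of_type_algebra = UNIV" "\<one>\<^bsub>ring_of_type_algebra\<^esub> = 1" "\<zero>\<^bsub>ring_of_type_algebra\<^esub> = 0"
  "x \<oplus>\<^bsub>ring_of_type_algebra\<^esub> y = x + y" "x \<otimes>\<^bsub>ring_of_type_algebra\<^esub> y = x * y"
  by (simp_all add: ring_of_type_algebra_def)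

lemma a_inv_ring_of_type_algebra: "\<ominus>\<^bsub>ring_of_type_algebra\<^esub> x = - (x :: 'a::field)"
proof -
  interpret R: Ring.field "ring_of_type_algebra :: 'a ring" by (rule field_from_type_algebra)
  show ?thesis
    by (rule R.minus_equality) (simp_all add: ring_of_type_algebra_simps)
qed

lemma m_inv_ring_of_type_algebra:
  assumes "x \<noteq> 0"
  shows "inv\<^bsub>ring_of_type_algebra\<^esub> x = inverse (x :: 'a::field)"
proof -
  interpret R: Ring.field "ring_of_type_algebra :: 'a ring" by (rule field_from_type_algebra)
  show ?thesis
    by (rule R.comm_inv_char) (simp_all add: ring_of_type_algebra_simps assms)
qed

abbreviation gen_field :: "'a::field set \<Rightarrow> 'a set" where
  "gen_field \<equiv> generate_field ring_of_type_algebra"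

lemma gen_field_1: "1 \<in> gen_field H"
  using generate_field.one[of ring_of_type_algebra H] by (simp add: ring_of_type_algebra_simps)

lemma gen_field_add: "x \<in> gen_field H \<Longrightarrow> y \<in> gen_field H \<Longrightarrow> x + y \<in> gen_field H"
  using generate_field.eng_add[of x ring_of_type_algebra H y] by (simp add: ring_of_type_algebra_simps)

lemma gen_field_mult: "x \<in> gen_field H \<Longrightarrow> y \<in> gen_field H \<Longrightarrow> x * y \<in> gen_field H"
  using generate_field.eng_mult[of x ring_of_type_algebra H y] by (simp add: ring_of_type_algebra_simps)

lemma gen_field_uminus: "x \<in> gen_field H \<Longrightarrow> - x \<in> gen_field H"
  using generate_field.a_inv[of x ring_of_type_algebra H] by (simp add: a_inv_ring_of_type_algebra)

lemma gen_field_0: "0 \<in> gen_field H"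
  using gen_field_add[OF gen_field_1 gen_field_uminus[OF gen_field_1]] by simp

lemma gen_field_inverse: "x \<in> gen_field H \<Longrightarrow> inverse x \<in> gen_field H"
  using generate_field.m_inv[of x ring_of_type_algebra H]
  \<comment> \<open>At 0 the type class convention \<open>inverse 0 = 0\<close> applies, since the
    generation rule inverts nonzero elements only.\<close>
  by (cases "x = 0") (simp_all add: m_inv_ring_of_type_algebra ring_of_type_algebra_simps)

lemma gen_field_divide: "x \<in> gen_field H \<Longrightarrow> y \<in> gen_field H \<Longrightarrow> x / y \<in> gen_field H"
  by (simp add: divide_inverse gen_field_mult gen_field_inverse)

lemma closed_semiring_gen_field: "closed_semiring (gen_field H)"
  by (simp add: closed_semiring_def gen_field_0 gen_field_1 gen_field_add gen_field_mult)

lemma gen_field_induct [consumes 1, case_names one incl uminus inverse add mult]: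
  assumes "x \<in> gen_field H" "P 1" "\<And>x. x \<in> H \<Longrightarrow> P x" "\<And>x. P x \<Longrightarrow> P (- x)"
    "\<And>x. x \<noteq> 0 \<Longrightarrow> P x \<Longrightarrow> P (inverse x)"
    "\<And>x y. P x \<Longrightarrow> P y \<Longrightarrow> P (x + y)" "\<And>x y. P x \<Longrightarrow> P y \<Longrightarrow> P (x * y)"
  shows "P x"
  using assms(1)
  by (induction rule: generate_field.induct)
    (use assms(2-) in \<open>simp_all add: ring_of_type_algebra_simps a_inv_ring_of_type_algebra m_inv_ring_of_type_algebra\<close>)


section \<open>Finiteness of the numerical invariants\<close>

context faithful_rep
begin

abbreviation "N \<equiv> card (carrier G)"

lemma N_pos: "0 < N"
  using finite_G G.one_closed by (auto simp: card_gt_0_iff)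

section \<open>Integrality through orbit polynomials\<close>

lemma Ale_mono: "d \<le> d' \<Longrightarrow> Ale d \<subseteq> Ale d'"
  by (auto simp: poly_ring_le_eq intro: polys_le_mono)

lemma Ale_mult: "p \<in> Ale d \<Longrightarrow> q \<in> Ale d' \<Longrightarrow> p * q \<in> Ale (d + d')"
  by (simp add: poly_ring_le_eq A_mult polys_le_mult)

lemma Ale_1: "1 \<in> Ale d"
  by (simp add: poly_ring_le_eq A_1)

lemma Ale_power: "p \<in> Ale 1 \<Longrightarrow> p ^ e \<in> Ale e"
  by (induction e) (use Ale_mult[of p 1] in \<open>auto simp: Ale_1\<close>)

text \<open>The coefficient of \<open>T\<^bsup>N - k\<^esup>\<close> in the orbit polynomial \<open>\<Prod>\<^sub>g (T - g x)\<close>.\<close>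

definition orbit_coeff :: "'k mpoly \<Rightarrow> nat \<Rightarrow> 'k mpoly" where
  "orbit_coeff x k = (\<Sum>T | T \<subseteq> carrier G \<and> card T = k. \<Prod>g\<in>T. - act g x)"

lemma orbit_coeff_le: "x \<in> Ale 1 \<Longrightarrow> orbit_coeff x k \<in> Ale k"
proof -
  assume x: "x \<in> Ale 1"
  have 1: "- act g x \<in> A" "- act g x \<in> polys_le 1" for g
    using act_le[OF x, of g] by (auto simp: poly_ring_le_eq A_uminus polys_le_uminus)
  have "(\<Prod>g\<in>T. - act g x) \<in> polys_le k" if "card T = k" for T
    using polys_le_prod[of T "\<lambda>g. - act g x" "\<lambda>_. 1"] 1(2) that by simp
  then show ?thesis
    unfolding poly_ring_le_eq orbit_coeff_def using 1(1)
    by (auto intro!: closed_semiring_sum[OF closed_semiring_A] closed_semiring_prod[OF closed_semiring_A] polys_le_sum)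
qed

text \<open>Left multiplication by \<open>h\<close> permutes the subsets of size \<open>k\<close>,
  and with them the summands.\<close>

lemma orbit_coeff_Inv: "x \<in> Ale 1 \<Longrightarrow> orbit_coeff x k \<in> Inv"
  unfolding Inv_iff
proof (intro conjI ballI)
  assume x: "x \<in> Ale 1"
  show "orbit_coeff x k \<in> A" using orbit_coeff_le[OF x] by (auto simp: poly_ring_le_eq)
  fix h assume h: "h \<in> carrier G"
  let ?l = "\<lambda>g. h \<otimes>\<^bsub>G\<^esub> g" and ?S = "{T. T \<subseteq> carrier G \<and> card T = k}"
  have inj: "inj_on ?l (carrier G)" using bij_lmult[OF h] by (simp add: bij_betw_def)
  have eq: "act h (\<Prod>g\<in>T. - act g x) = (\<Prod>g\<in>?l ` T. - act g x)" if "T \<in> ?S" for T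
  proof -
    have "act h (\<Prod>g\<in>T. - act g x) = (\<Prod>g\<in>T. - act (?l g) x)"
      unfolding act_prod act_uminus using that h by (intro prod.cong refl) (auto simp: act_act)
    also have "\<dots> = (\<Prod>g\<in>?l ` T. - act g x)"
      using prod.reindex[OF inj_on_subset[OF inj], of T "\<lambda>g. - act g x"] that by simp
    finally show ?thesis .
  qed
  have bij: "bij_betw (image ?l) ?S ?S"
  proof -
    have "bij_betw (image ?l) (Pow (carrier G)) (Pow (carrier G))"
      by (rule bij_betw_Pow[OF bij_lmult[OF h]])
    then have inj': "inj_on (image ?l) ?S" by (auto simp: bij_betw_def intro: inj_on_subset)
    have "image ?l ` ?S \<subseteq> ?S"
    proof (rule image_subsetI)
      fix T assume "T \<in> ?S"
      then show "?l ` T \<in> ?S" using card_image[OF inj_on_subset[OF inj], of T] h by auto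
    qed
    moreover have "finite ?S" using finite_G by simp
    ultimately show ?thesis using inj' by (simp add: bij_betw_def endo_inj_surj)
  qed
  have "act h (orbit_coeff x k) = (\<Sum>T\<in>?S. \<Prod>g\<in>?l ` T. - act g x)"
    unfolding orbit_coeff_def act_sum by (rule sum.cong[OF refl]) (rule eq)
  also have "\<dots> = orbit_coeff x k"
    unfolding orbit_coeff_def by (rule sum.reindex_bij_betw[OF bij])
  finally show "act h (orbit_coeff x k) = orbit_coeff x k" .
qed

text \<open>\<open>x\<close> is a root of its own orbit polynomial because of the factor at the
  identity. Expanding the product over subsets and grouping these by size produces the
  coefficients.\<close>

lemma orbit_equation:
  assumes x: "x \<in> Ale 1"
  shows "x ^ N = (\<Sum>k=1..N. (- orbit_coeff x k) * x ^ (N - k))"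
proof -
  have xA: "x \<in> A" using x by (simp add: poly_ring_le_eq)
  have "0 = (\<Prod>g\<in>carrier G. - act g x + x)"
    using finite_G act_one[OF xA] by (intro prod_zero[symmetric] bexI[of _ "\<one>\<^bsub>G\<^esub>"]) auto
  also have "\<dots> = (\<Sum>T\<in>Pow (carrier G). (\<Prod>g\<in>T. - act g x) * x ^ (N - card T))"
    unfolding prod_add[OF finite_G] using finite_G
    by (intro sum.cong refl) (auto simp: card_Diff_subset finite_subset)
  also have "\<dots> = (\<Sum>k\<in>{0..N}. \<Sum>T | T \<in> Pow (carrier G) \<and> card T = k. (\<Prod>g\<in>T. - act g x) * x ^ (N - card T))"
    by (rule sum.group[symmetric]) (use finite_G in \<open>auto intro: card_mono\<close>)
  also have "\<dots> = (\<Sum>k=0..N. orbit_coeff x k * x ^ (N - k))"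
    unfolding orbit_coeff_def sum_distrib_right by (intro sum.cong refl) auto
  also have "\<dots> = orbit_coeff x 0 * x ^ N + (\<Sum>k=1..N. orbit_coeff x k * x ^ (N - k))"
    by (simp add: sum.atLeast_Suc_atMost)
  also have "orbit_coeff x 0 = 1"
  proof -
    \<comment> \<open>Finiteness matters here: an infinite set would also have \<open>card\<close>
      equal to 0.\<close>
    have "{T. T \<subseteq> carrier G \<and> card T = 0} = {{}}"
      using finite_G by (auto dest: finite_subset)
    then show ?thesis by (simp add: orbit_coeff_def)
  qed
  finally show ?thesis
    by (simp add: sum_negf eq_neg_iff_add_eq_0)
qed

text \<open>\<open>B\<close> is general for the sake of two uses: it is \<open>Inv\<close> for the
  module bound, and for the field bound the invariants already generated in bounded degree. In both
  cases it contains the orbit coefficients, whose degree is at most \<open>N\<close>.\<close>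

lemma power_in_span:
  assumes B: "closed_semiring B" "Inv \<inter> Ale N \<subseteq> B" and x: "x \<in> Ale 1"
  shows "x ^ e \<in> span_over B ((\<lambda>i. x ^ i) ` {..<N})"
proof (induction e)
  case 0
  show ?case
    using N_pos by (intro span_over_base closed_semiringD[OF B(1)]) (auto intro: image_eqI[of _ _ 0])
next
  case (Suc e)
  have top: "x ^ N \<in> span_over B ((\<lambda>i. x ^ i) ` {..<N})"
    unfolding orbit_equation[OF x]
  proof (intro span_over_sum[OF B(1)] span_over_scale[OF B(1)])
    fix k assume k: "k \<in> {1..N}"
    have "- orbit_coeff x k \<in> Ale N"
      using orbit_coeff_le[OF x, of k] k
      by (auto simp: poly_ring_le_eq A_uminus intro: polys_le_uminus polys_le_mono)
    then show "- orbit_coeff x k \<in> B" using B(2) orbit_coeff_Inv[OF x] Inv_uminus by blast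
    show "x ^ (N - k) \<in> span_over B ((\<lambda>i. x ^ i) ` {..<N})"
      using k by (intro span_over_base closed_semiringD[OF B(1)]) auto
  qed
  from Suc.IH have "x * x ^ e \<in> span_over B ((\<lambda>i. x ^ i) ` {..<N})"
  proof (induction rule: span_over_induct)
    case zero
    then show ?case by (simp add: span_over_0)
  next
    case (add r s y)
    then obtain i where i: "s = x ^ i" "i < N" by auto
    have "x ^ Suc i \<in> span_over B ((\<lambda>i. x ^ i) ` {..<N})"
    \<comment> \<open>Multiplication by \<open>x\<close> leaves the allowed exponents only at
      \<open>N - 1\<close>, where \<open>top\<close> applies.\<close>
    proof (cases "Suc i = N")
      case True then show ?thesis using top by simp
    next
      case False
      then show ?thesis using i by (intro span_over_base closed_semiringD[OF B(1)] imageI) auto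
    qed
    moreover have "x * (r * s + y) = r * x ^ Suc i + x * y" by (simp add: i algebra_simps)
    ultimately show ?case using add by (simp add: span_over_add[OF B(1)] span_over_scale[OF B(1)])
  qed
  then show ?case by simp
qed

text \<open>Each of at most \<open>dm\<close> variables in a monomial is reduced to exponents below
  \<open>N\<close>, so it contributes at most \<open>N\<close> to the degree.\<close>

lemma A_subset_span:
  assumes B: "closed_semiring B" "Inv \<inter> Ale N \<subseteq> B"
  shows "A \<subseteq> span_over B (Ale (N * dm))"
proof
  fix p assume p: "p \<in> A"
  have const: "pconst c \<in> B" for c
    using B(2) Inv_pconst A_pconst by (auto simp: poly_ring_le_eq)
  have "pconst c * (\<Prod>i\<in>Poly_Mapping.keys m. pvar i ^ Poly_Mapping.lookup m i) \<in> span_over B (Ale (N * dm))"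
    if m: "Poly_Mapping.keys m \<subseteq> {..<dm}" for c m
  proof (rule span_over_scale[OF B(1) const])
    have "pvar i ^ e \<in> span_over B (Ale N)" if "i < dm" for i e
    proof -
      have x: "pvar i \<in> Ale 1" using that by (simp add: poly_ring_le_eq poly_ring_eq polys_in_pvar polys_le_pvar)
      have "(\<lambda>i'. pvar i ^ i') ` {..<N} \<subseteq> Ale N"
        by (rule image_subsetI, rule subsetD[OF Ale_mono Ale_power[OF x]]) auto
      then show ?thesis using power_in_span[OF B x, of e] span_over_mono[OF subset_refl] by blast
    qed
    then have "(\<Prod>i\<in>Poly_Mapping.keys m. pvar i ^ Poly_Mapping.lookup m i)
        \<in> span_over B (Ale (\<Sum>i\<in>Poly_Mapping.keys m. N))"
      using m by (intro span_over_prod[OF B(1)]) (auto simp: Ale_1 Ale_mult)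
    moreover have "(\<Sum>i\<in>Poly_Mapping.keys m. N) \<le> N * dm"
      using card_mono[OF _ m] by simp
    ultimately show "(\<Prod>i\<in>Poly_Mapping.keys m. pvar i ^ Poly_Mapping.lookup m i) \<in> span_over B (Ale (N * dm))"
      using span_over_mono[OF subset_refl Ale_mono] by blast
  qed
  then have "psubst pvar p \<in> span_over B (Ale (N * dm))"
    unfolding psubst_def using p
    by (intro span_over_sum[OF B(1)]) (auto simp: poly_ring_def)
  then show "p \<in> span_over B (Ale (N * dm))" by simp
qed

lemma span_Inv_subset: "span_over Inv (Ale d) \<subseteq> A"
  by (rule span_over_subset[OF closed_semiring_Inv]) (auto simp: poly_ring_le_eq A_add A_mult A_0 Inv_iff)

lemma topdeg_le:
  assumes "A \<subseteq> span_over Inv (Ale d)"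
  shows "topdeg scale G V \<rho> \<le> d"
  unfolding topdeg_def using assms span_Inv_subset by (intro Least_le) blast

text \<open>The bound \<open>N * dm\<close> shows that some degree generates, so the least one is
  attained.\<close>

lemma topdeg_span: "A \<subseteq> span_over Inv (Ale (topdeg scale G V \<rho>))"
proof -
  have "\<exists>d. span_over Inv (Ale d) = A"
    using A_subset_span[OF closed_semiring_Inv] span_Inv_subset by blast
  then have "span_over Inv (Ale (topdeg scale G V \<rho>)) = A"
    unfolding topdeg_def by (rule LeastI_ex)
  then show ?thesis by blast
qed


section \<open>Spanning the field of fractions over the invariant field\<close>

lemma A_ex_Ale:
  assumes "p \<in> A"
  obtains d where "p \<in> Ale d"
  using ex_polys_le[of p] assms by (auto simp: poly_ring_le_eq)

lemma Fract_frac_field: "p \<in> A \<Longrightarrow> q \<in> A \<Longrightarrow> q \<noteq> 0 \<Longrightarrow> Fract p q \<in> frac_field scale V"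
  unfolding frac_field_def by blast

lemma to_fract_frac_field: "p \<in> A \<Longrightarrow> to_fract p \<in> frac_field scale V"
  unfolding to_fract_def by (intro Fract_frac_field A_1) auto

lemma Fract_frac_inv: "p \<in> Inv \<Longrightarrow> q \<in> Inv \<Longrightarrow> q \<noteq> 0 \<Longrightarrow> Fract p q \<in> frac_inv scale G V \<rho>"
  unfolding frac_inv_eq by blast

lemma to_fract_frac_inv: "p \<in> Inv \<Longrightarrow> to_fract p \<in> frac_inv scale G V \<rho>"
  unfolding to_fract_def by (intro Fract_frac_inv closed_semiringD[OF closed_semiring_Inv]) auto

lemma frac_inv_0: "0 \<in> frac_inv scale G V \<rho>"
  and frac_inv_1: "1 \<in> frac_inv scale G V \<rho>"
  using to_fract_frac_inv[of 0] to_fract_frac_inv[of 1] closed_semiringD(1,2)[OF closed_semiring_Inv] by simp_all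

lemma frac_inv_add:
  assumes "x \<in> frac_inv scale G V \<rho>" "y \<in> frac_inv scale G V \<rho>"
  shows "x + y \<in> frac_inv scale G V \<rho>"
proof -
  obtain p q p' q' where *: "x = Fract p q" "y = Fract p' q'" "p \<in> Inv" "q \<in> Inv" "p' \<in> Inv" "q' \<in> Inv" "q \<noteq> 0" "q' \<noteq> 0"
    using assms by (auto simp: frac_inv_eq)
  then show ?thesis by (auto intro!: Fract_frac_inv closed_semiringD[OF closed_semiring_Inv])
qed

lemma frac_inv_mult:
  assumes "x \<in> frac_inv scale G V \<rho>" "y \<in> frac_inv scale G V \<rho>"
  shows "x * y \<in> frac_inv scale G V \<rho>"
proof -
  obtain p q p' q' where *: "x = Fract p q" "y = Fract p' q'" "p \<in> Inv" "q \<in> Inv" "p' \<in> Inv" "q' \<in> Inv" "q \<noteq> 0" "q' \<noteq> 0"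
    using assms by (auto simp: frac_inv_eq)
  then show ?thesis by (auto intro!: Fract_frac_inv closed_semiringD[OF closed_semiring_Inv])
qed

lemma frac_inv_uminus: "x \<in> frac_inv scale G V \<rho> \<Longrightarrow> - x \<in> frac_inv scale G V \<rho>"
  using Inv_uminus by (auto simp: frac_inv_eq) blast

lemma frac_inv_inverse: "x \<noteq> 0 \<Longrightarrow> x \<in> frac_inv scale G V \<rho> \<Longrightarrow> inverse x \<in> frac_inv scale G V \<rho>"
proof -
  assume x: "x \<noteq> 0" "x \<in> frac_inv scale G V \<rho>"
  then obtain p q where "x = Fract p q" "p \<in> Inv" "q \<in> Inv" "q \<noteq> 0" by (auto simp: frac_inv_eq)
  with x(1) show ?thesis by (auto simp: Zero_fract_def eq_fract intro!: Fract_frac_inv)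
qed

lemma closed_semiring_frac_inv: "closed_semiring (frac_inv scale G V \<rho>)"
  by (simp add: closed_semiring_def frac_inv_0 frac_inv_1 frac_inv_add frac_inv_mult)

abbreviation spans_field :: "nat \<Rightarrow> bool" where
  "spans_field d \<equiv>
     span_over (frac_inv scale G V \<rho>) (to_fract ` Ale d) = frac_field scale V"

text \<open>Clearing denominators gives a criterion on polynomials alone, which can be transported
  along the embeddings of the summand rings.\<close>

lemma spans_field_iff:
  "spans_field d \<longleftrightarrow> (\<forall>f\<in>A. \<exists>q\<in>Inv. q \<noteq> 0 \<and> q * f \<in> span_over Inv (Ale d))"
proof
  let ?K = "frac_inv scale G V \<rho>"
  note R = closed_semiring_Inv
  assume *: "spans_field d"
  show "\<forall>f\<in>A. \<exists>q\<in>Inv. q \<noteq> 0 \<and> q * f \<in> span_over Inv (Ale d)"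
  proof
    fix f assume f: "f \<in> A"
    then have "to_fract f \<in> span_over ?K (to_fract ` Ale d)"
      unfolding * by (rule to_fract_frac_field)
    \<comment> \<open>Stated so as to generalize to every element of the span: the partial sums in
      the induction are fractions.\<close>
    then have "\<exists>q\<in>Inv. q \<noteq> 0 \<and> (\<exists>y\<in>span_over Inv (Ale d). to_fract q * to_fract f = to_fract y)"
    proof (induction rule: span_over_induct)
      case zero
      then show ?case using closed_semiringD(2)[OF R] span_over_0 by (intro bexI[of _ 1]) auto
    next
      case (add r s x)
      from add.IH obtain q y where q: "q \<in> Inv" "q \<noteq> 0" "y \<in> span_over Inv (Ale d)" "to_fract q * x = to_fract y"
        by blast
      obtain a b where r: "r = Fract a b" "a \<in> Inv" "b \<in> Inv" "b \<noteq> 0" using add.hyps by (auto simp: frac_inv_eq)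
      obtain t where t: "s = to_fract t" "t \<in> Ale d" using add.hyps by blast
      \<comment> \<open>\<open>b\<close> clears the new coefficient and \<open>q\<close> the sum so
        far.\<close>
      have "to_fract (b * q) * (r * s + x) = to_fract (q * a * t + b * y)"
        using r(4) by (simp add: r(1) t(1) Fract_conv_to_fract field_simps flip: q(4))
      moreover have "q * a * t + b * y \<in> span_over Inv (Ale d)"
        using r t q closed_semiringD(2,4)[OF R]
        by (simp add: span_over_add[OF R] span_over_scale[OF R] span_over_base)
      moreover have "b * q \<in> Inv" "b * q \<noteq> 0" using r q closed_semiringD(4)[OF R] by auto
      ultimately show ?case by blast
    qed
    then show "\<exists>q\<in>Inv. q \<noteq> 0 \<and> q * f \<in> span_over Inv (Ale d)"
      by (metis to_fract_eq_iff to_fract_mult)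
  qed
next
  let ?K = "frac_inv scale G V \<rho>"
  assume *: "\<forall>f\<in>A. \<exists>q\<in>Inv. q \<noteq> 0 \<and> q * f \<in> span_over Inv (Ale d)"
  show "spans_field d"
  proof
    have K: "?K \<subseteq> frac_field scale V" by (simp add: frac_inv_def)
    show "span_over ?K (to_fract ` Ale d) \<subseteq> frac_field scale V"
    proof (rule span_over_subset[OF closed_semiring_frac_inv])
      show "to_fract ` Ale d \<subseteq> frac_field scale V"
        by (auto simp: poly_ring_le_eq intro: to_fract_frac_field)
      show "0 \<in> frac_field scale V" using K frac_inv_0 by blast
      show "x + y \<in> frac_field scale V" if xy: "x \<in> frac_field scale V" "y \<in> frac_field scale V" for x y
      proof -
        obtain p q p' q' where "x = Fract p q" "y = Fract p' q'" "p \<in> A" "q \<in> A" "p' \<in> A" "q' \<in> A" "q \<noteq> 0" "q' \<noteq> 0"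
          using xy by (auto simp: frac_field_def)
        then have "x + y = Fract (p * q' + p' * q) (q * q')" "p * q' + p' * q \<in> A" "q * q' \<in> A" "q * q' \<noteq> 0"
          by (auto simp: A_add A_mult)
        then show ?thesis unfolding frac_field_def by blast
      qed
      show "x * y \<in> frac_field scale V" if xy: "x \<in> ?K" "y \<in> frac_field scale V" for x y
      proof -
        have "x \<in> frac_field scale V" using xy(1) K by blast
        then obtain p q p' q' where "x = Fract p q" "y = Fract p' q'" "p \<in> A" "q \<in> A" "p' \<in> A" "q' \<in> A" "q \<noteq> 0" "q' \<noteq> 0"
          using xy(2) by (auto simp: frac_field_def)
        then have "x * y = Fract (p * p') (q * q')" "p * p' \<in> A" "q * q' \<in> A" "q * q' \<noteq> 0"
          by (auto simp: A_mult)
        then show ?thesis unfolding frac_field_def by blast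
      qed
    qed
    show "frac_field scale V \<subseteq> span_over ?K (to_fract ` Ale d)"
    proof
      fix x assume "x \<in> frac_field scale V"
      then obtain p q where x: "x = Fract p q" "p \<in> A" "q \<in> A" "q \<noteq> 0" by (auto simp: frac_field_def)
      \<comment> \<open>\<open>x\<close> is \<open>p' * p\<close> over the invariant
        \<open>Nm q\<close>; the factor \<open>c\<close> below then brings the numerator into the
        span.\<close>
      obtain p' where p': "p' \<in> A" "Nm q = p' * q" using Nm_multiple x(3) by blast
      have n: "Nm q \<in> Inv" "Nm q \<noteq> 0" using x Nm_Inv Nm_nonzero by auto
      obtain c where c: "c \<in> Inv" "c \<noteq> 0" "c * (p' * p) \<in> span_over Inv (Ale d)"
        using * A_mult[OF p'(1) x(2)] by blast
      have "p' \<noteq> 0" using n p' by auto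
      then have "x = Fract 1 (c * Nm q) * to_fract (c * (p' * p))"
        using c(2) x(4) by (simp add: x(1) p'(2) to_fract_def eq_fract)
      moreover have "Fract 1 (c * Nm q) \<in> ?K"
        using c n closed_semiringD(2,4)[OF closed_semiring_Inv] by (intro Fract_frac_inv) auto
      moreover have "to_fract (c * (p' * p)) \<in> span_over ?K (to_fract ` Ale d)"
        using c(3)
      proof (induction rule: span_over_induct)
        case (add r s y)
        then show ?case
          by (simp add: span_over_add span_over_scale span_over_base closed_semiring_frac_inv
              to_fract_frac_inv frac_inv_1)
      qed (simp add: span_over_0)
      ultimately show "x \<in> span_over ?K (to_fract ` Ale d)"
        by (simp add: span_over_scale[OF closed_semiring_frac_inv])
    qed
  qed
qed

lemma D_span_le: "spans_field d \<Longrightarrow> D_span scale G V \<rho> \<le> d"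
  unfolding D_span_def by (rule Least_le)

lemma D_span_spans: "spans_field (D_span scale G V \<rho>)"
  unfolding D_span_def
proof (rule LeastI)
  \<comment> \<open>Module generators over the invariants also span the field, so
    \<open>topdeg\<close> is a degree that works.\<close>
  have "1 * f \<in> span_over Inv (Ale (topdeg scale G V \<rho>))" if "f \<in> A" for f
    using topdeg_span that by auto
  then show "spans_field (topdeg scale G V \<rho>)"
    unfolding spans_field_iff by (metis closed_semiringD(2)[OF closed_semiring_Inv] one_neq_zero)
qed

section \<open>Generating the field of invariants\<close>

abbreviation inv_field :: "nat \<Rightarrow> 'k mpoly fract set" where
  "inv_field d \<equiv> gen_field (to_fract ` (range pconst \<union> (Inv \<inter> Ale d)))"

lemma inv_field_incl: "p \<in> Inv \<Longrightarrow> p \<in> Ale d \<Longrightarrow> to_fract p \<in> inv_field d"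
  by (rule generate_field.incl) auto

lemma inv_field_subset: "inv_field d \<subseteq> frac_inv scale G V \<rho>"
proof
  fix x assume "x \<in> inv_field d"
  then show "x \<in> frac_inv scale G V \<rho>"
    by (induction rule: gen_field_induct)
      (auto intro: frac_inv_1 frac_inv_uminus frac_inv_inverse frac_inv_add frac_inv_mult
        to_fract_frac_inv Inv_pconst)
qed

text \<open>By \<open>frac_inv_eq\<close> every invariant fraction is a quotient of invariant
  polynomials, so only these have to be reached.\<close>

lemma inv_field_eq_iff: "inv_field d = frac_inv scale G V \<rho> \<longleftrightarrow> (\<forall>p\<in>Inv. to_fract p \<in> inv_field d)"
proof
  assume *: "\<forall>p\<in>Inv. to_fract p \<in> inv_field d"
  have "frac_inv scale G V \<rho> \<subseteq> inv_field d"
    using * by (auto simp: frac_inv_eq Fract_conv_to_fract intro: gen_field_divide)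
  with inv_field_subset show "inv_field d = frac_inv scale G V \<rho>" by blast
qed (auto intro: to_fract_frac_inv)

text \<open>
  If \<open>Tr e \<noteq> 0\<close> and \<open>p\<close> is invariant then \<open>p = Tr (p e) / Tr e\<close>; expanding \<open>p e\<close> in finitely many
  module generators bounds the degrees that are needed.
\<close>

lemma ex_inv_field_eq: "\<exists>d. inv_field d = frac_inv scale G V \<rho>"
proof -
  obtain e where e: "e \<in> A" "Tr e \<noteq> 0" using ex_Tr_nonzero by blast
  obtain d0 where d0: "Tr e \<in> Ale d0" using A_ex_Ale[of "Tr e"] Tr_Inv[OF e(1)] by (auto simp: Inv_iff)
  \<comment> \<open>The summands pay, in order, for the orbit coefficients, for the traces of the
    module generators and for \<open>Tr e\<close>.\<close>
  define d where "d = N + N * dm + d0"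
  \<comment> \<open>The invariants already reached in degree \<open>d\<close>. They contain the
    orbit coefficients, so \<open>A_subset_span\<close> applies over \<open>B\<close> and all
    coefficients stay inside the generated field.\<close>
  define B where "B = {b \<in> Inv. to_fract b \<in> inv_field d}"
  have B: "closed_semiring B"
    using closed_semiringD[OF closed_semiring_Inv] closed_semiringD[OF closed_semiring_gen_field]
    by (auto simp: B_def closed_semiring_def)
  have in_B: "p \<in> B" if "p \<in> Inv" "p \<in> Ale d'" "d' \<le> d" for p d'
    using that Ale_mono[of d' d] inv_field_incl by (auto simp: B_def)
  have gen: "A \<subseteq> span_over B (Ale (N * dm))"
    by (rule A_subset_span[OF B]) (auto intro: in_B simp: d_def)
  have "to_fract p \<in> inv_field d" if p: "p \<in> Inv" for p
  proof -
    have "p * e \<in> span_over B (Ale (N * dm))" using gen p e A_mult by (auto simp: Inv_iff)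
    then have "Tr (p * e) \<in> B"
    proof (induction rule: span_over_induct)
      case zero
      then show ?case using closed_semiringD(1)[OF B] by simp
    next
      case (add r s x)
      have "Tr s \<in> B"
        using add Tr_le Tr_Inv[of s] by (intro in_B[of _ "N * dm"]) (auto simp: poly_ring_le_eq d_def)
      moreover have "r \<in> Inv" using add by (simp add: B_def)
      ultimately show ?case
        using add closed_semiringD(3,4)[OF B] by (simp add: Tr_add Tr_mult_Inv)
    qed
    moreover have "Tr e \<in> B" using Tr_Inv[OF e(1)] d0 by (rule in_B) (simp add: d_def)
    moreover have "to_fract p = to_fract (Tr (p * e)) / to_fract (Tr e)"
      using e(2) p by (simp add: Tr_mult_Inv)
    ultimately show ?thesis by (simp add: B_def gen_field_divide)
  qed
  then show ?thesis using inv_field_eq_iff by blast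
qed

lemma beta_field_inv: "p \<in> Inv \<Longrightarrow> to_fract p \<in> inv_field (beta_field scale G V \<rho>)"
proof -
  have "inv_field (beta_field scale G V \<rho>) = frac_inv scale G V \<rho>"
    unfolding beta_field_def by (rule LeastI_ex[OF ex_inv_field_eq])
  then show "p \<in> Inv \<Longrightarrow> to_fract p \<in> inv_field (beta_field scale G V \<rho>)"
    by (simp add: to_fract_frac_inv)
qed

lemma beta_field_le: "(\<And>p. p \<in> Inv \<Longrightarrow> to_fract p \<in> inv_field d) \<Longrightarrow> beta_field scale G V \<rho> \<le> d"
  unfolding beta_field_def by (rule Least_le) (simp add: inv_field_eq_iff)

end


section \<open>Direct sums of representations\<close>

locale direct_sum_rep = faithful_rep G scale V \<rho>
  for G :: "('g, 'm) monoid_scheme"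
    and scale :: "'k::field \<Rightarrow> 'v::ab_group_add \<Rightarrow> 'v" and V \<rho> +
  fixes I :: "'i set" and W :: "'i \<Rightarrow> 'v set"
  assumes finite_I: "finite I"
    and subrep: "\<And>i. i \<in> I \<Longrightarrow> subrep scale G \<rho> (W i)"
    and direct_sum: "internal_direct_sum I W V"
begin

abbreviation "Gr i \<equiv> rep_image scale G \<rho> (W i)"
abbreviation "res i \<equiv> restrict_rep \<rho> (W i)"

section \<open>Projections onto the summands\<close>

lemma subspace_W: "i \<in> I \<Longrightarrow> subspace (W i)"
  and rho_W: "i \<in> I \<Longrightarrow> g \<in> carrier G \<Longrightarrow> w \<in> W i \<Longrightarrow> \<rho> g w \<in> W i"
  using subrep by (auto simp: subrep_def)

definition pr :: "'i \<Rightarrow> 'v \<Rightarrow> 'v" where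
  "pr i v = inv_into (\<Pi>\<^sub>E i\<in>I. W i) (\<lambda>w. \<Sum>i\<in>I. w i) v i"

lemma bij_sum: "bij_betw (\<lambda>w. \<Sum>i\<in>I. w i) (\<Pi>\<^sub>E i\<in>I. W i) V"
  using direct_sum by (simp add: internal_direct_sum_def)

lemma pr_mem: "v \<in> V \<Longrightarrow> i \<in> I \<Longrightarrow> pr i v \<in> W i"
  using bij_betwE[OF bij_betw_inv_into[OF bij_sum]] by (auto simp: pr_def dest: PiE_mem)

lemma pr_sum: "v \<in> V \<Longrightarrow> (\<Sum>i\<in>I. pr i v) = v"
  unfolding pr_def using bij_betw_inv_into_right[OF bij_sum] by auto

text \<open>Uniqueness of the decomposition. Linearity and equivariance of \<open>pr\<close> follow
  by exhibiting the expected components.\<close>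

lemma pr_eqI:
  assumes w: "\<And>i. i \<in> I \<Longrightarrow> w i \<in> W i" and v: "v = (\<Sum>i\<in>I. w i)" and i: "i \<in> I"
  shows "pr i v = w i"
proof -
  have "restrict w I \<in> (\<Pi>\<^sub>E i\<in>I. W i)" using w by auto
  from bij_betw_inv_into_left[OF bij_sum this]
  have "inv_into (\<Pi>\<^sub>E i\<in>I. W i) (\<lambda>w. \<Sum>i\<in>I. w i) v = restrict w I" by (simp add: v)
  then show ?thesis using i by (simp add: pr_def)
qed

lemma W_subset: 
  assumes i: "i \<in> I"
  shows "W i \<subseteq> V"
proof
  fix x assume x: "x \<in> W i"
  have "(\<lambda>j\<in>I. if j = i then x else 0) \<in> (\<Pi>\<^sub>E i\<in>I. W i)"
    using x subspace_0[OF subspace_W] by auto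
  from bij_betwE[OF bij_sum, rule_format, OF this] show "x \<in> V"
    using i finite_I by simp
qed

lemma pr_W:
  assumes i: "i \<in> I" and x: "x \<in> W i"
  shows "pr i x = x"
  using pr_eqI[of "\<lambda>j. if j = i then x else 0" x i] i x finite_I subspace_0[OF subspace_W] by simp

lemma pr_linear: "i \<in> I \<Longrightarrow> linear_map_on scale V (pr i)"
  unfolding linear_map_on_def
proof (intro conjI ballI allI)
  assume i: "i \<in> I"
  fix x assume x: "x \<in> V"
  show "pr i (x + y) = pr i x + pr i y" if y: "y \<in> V" for y
    using pr_mem[OF x] pr_mem[OF y] i
    by (intro pr_eqI[of "\<lambda>i. pr i x + pr i y"])
      (simp_all add: sum.distrib pr_sum x y subspace_add[OF subspace_W])
  show "pr i (scale c x) = scale c (pr i x)" for c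
    using pr_mem[OF x] i
    by (intro pr_eqI[of "\<lambda>i. scale c (pr i x)"])
      (simp_all add: pr_sum x subspace_scale[OF subspace_W] flip: scale_sum_right)
qed

lemma rho_sum_pr: "g \<in> carrier G \<Longrightarrow> v \<in> V \<Longrightarrow> \<rho> g v = (\<Sum>i\<in>I. \<rho> g (pr i v))"
  using linear_map_on_sum[OF rho_linear subspace_V, of g I "\<lambda>i. pr i v"] pr_sum[of v] pr_mem[of v] W_subset
  by auto

lemma pr_rho: "g \<in> carrier G \<Longrightarrow> v \<in> V \<Longrightarrow> i \<in> I \<Longrightarrow> pr i (\<rho> g v) = \<rho> g (pr i v)"
  using rho_sum_pr rho_W pr_mem by (intro pr_eqI[of "\<lambda>i. \<rho> g (pr i v)"]) auto

section \<open>The image groups\<close>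

lemma Gr_eq: "Gr i = (BijGroup (W i))\<lparr>carrier := res i ` carrier G\<rparr>"
  by (simp add: rep_image_def GL_def)

text \<open>A subrepresentation is only required to be mapped into itself; surjectivity comes from
  applying this to the inverse element as well.\<close>

lemma res_Bij:
  assumes i: "i \<in> I" and g: "g \<in> carrier G"
  shows "res i g \<in> Bij (W i)"
proof -
  have "bij_betw (res i g) (W i) (W i)"
    using i g rho_W[OF i] W_subset[OF i]
    by (intro bij_betwI[where g = "\<rho> (inv\<^bsub>G\<^esub> g)"])
      (auto simp: restrict_rep_def rho_mult[symmetric] rho_one subset_iff)
  then show ?thesis by (simp add: Bij_def restrict_rep_def)
qed

lemma res_hom_Bij: "i \<in> I \<Longrightarrow> res i \<in> hom G (BijGroup (W i))"
proof (rule homI)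
  fix g h assume *: "i \<in> I" "g \<in> carrier G" "h \<in> carrier G"
  show "res i (g \<otimes>\<^bsub>G\<^esub> h) = res i g \<otimes>\<^bsub>BijGroup (W i)\<^esub> res i h"
    using * res_Bij[OF *(1,2)] res_Bij[OF *(1,3)] rho_W[OF *(1,3)] W_subset[OF *(1)]
    by (auto simp: BijGroup_def compose_def restrict_rep_def rho_mult subset_iff intro!: restrict_ext)
qed (simp add: BijGroup_def res_Bij)

lemma group_hom_res_Bij: "i \<in> I \<Longrightarrow> group_hom G (BijGroup (W i)) (res i)"
  using res_hom_Bij group_BijGroup G.is_group by (simp add: group_hom_def group_hom_axioms_def)

text \<open>\<open>GL\<close> and \<open>BijGroup\<close> differ only in the carrier, which
  \<open>rep_image\<close> overwrites. So the image group is the image of a homomorphism into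
  \<open>BijGroup\<close>, hence a subgroup there.\<close>

lemma group_Gr: "i \<in> I \<Longrightarrow> group (Gr i)"
  unfolding Gr_eq
  by (rule group.subgroup_imp_group[OF group_BijGroup group_hom.img_is_subgroup[OF group_hom_res_Bij]])

lemma res_hom: "i \<in> I \<Longrightarrow> res i \<in> hom G (Gr i)"
  using res_hom_Bij by (auto simp: hom_def Gr_eq)

lemma carrier_Gr: "carrier (Gr i) = res i ` carrier G"
  by (simp add: Gr_eq)

lemma inv_res:
  assumes "i \<in> I" "g \<in> carrier G"
  shows "inv\<^bsub>Gr i\<^esub> (res i g) = res i (inv\<^bsub>G\<^esub> g)"
proof -
  interpret group_hom G "Gr i" "res i"
    using res_hom group_Gr G.is_group assms by (simp add: group_hom_def group_hom_axioms_def)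
  show ?thesis using assms by simp
qed

lemma basis_W: "i \<in> I \<Longrightarrow> is_basis scale (basis_of scale (W i)) (W i)"
  by (rule is_basis_basis_of[OF subspace_W W_subset findim])

lemma basis_W_in: "i \<in> I \<Longrightarrow> b \<in> set (basis_of scale (W i)) \<Longrightarrow> b \<in> W i"
  using is_basisD(3)[OF basis_W] span_base by auto

text \<open>The tautological action is the identity function, so it is faithful even where
  \<open>G\<close> acts with a kernel on the summand.\<close>

lemma faithful_rep_Gr:
  assumes i: "i \<in> I"
  shows "faithful_rep (Gr i) scale (W i) (\<lambda>f. f)"
proof -
  have "findim_space scale (W i)"
    using is_basisD(3)[OF basis_W[OF i]] unfolding findim_space_def by blast
  moreover have "linear_rep scale (Gr i) (W i) (\<lambda>f. f)"
  proof -
    have "res i g \<in> carrier (GL scale (W i))" if g: "g \<in> carrier G" for g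
      using res_Bij[OF i g] rho_linear[OF g] W_subset[OF i] subspace_add[OF subspace_W[OF i]]
        subspace_scale[OF subspace_W[OF i]]
      by (auto simp: GL_def restrict_rep_def linear_map_on_def subset_iff)
    then show ?thesis by (auto simp: linear_rep_def hom_def carrier_Gr) (simp add: Gr_eq GL_def)
  qed
  ultimately show ?thesis
    using group_Gr[OF i] vector_space_axioms finite_G
    by (simp add: faithful_rep_def faithful_rep_axioms_def carrier_Gr)
qed

section \<open>Polynomials on a summand inside the polynomials on the whole space\<close>

abbreviation "A' i \<equiv> poly_ring scale (W i)"
abbreviation "Ale' i \<equiv> poly_ring_le scale (W i)"
abbreviation "act' i \<equiv> poly_act scale (Gr i) (W i) (\<lambda>f. f)"
abbreviation "Inv' i \<equiv> poly_inv scale (Gr i) (W i) (\<lambda>f. f)"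
abbreviation "Tr' i \<equiv> faithful_rep.Tr (Gr i) scale (W i) (\<lambda>f. f)"

definition ext :: "'i \<Rightarrow> 'k mpoly \<Rightarrow> 'k mpoly" where
  "ext i = psubst (pull scale (basis_of scale V) (basis_of scale (W i)) (pr i))"

text \<open>Restriction of polynomials to \<open>W i\<close>: the pullback along the inclusion,
  which is written \<open>id\<close>.\<close>

definition cores :: "'i \<Rightarrow> 'k mpoly \<Rightarrow> 'k mpoly" where
  "cores i = psubst (pull scale (basis_of scale (W i)) (basis_of scale V) id)"

lemma A'_eq: "A' i = polys_in {..<length (basis_of scale (W i))}"
  by (simp add: poly_ring_def polys_in_def)

lemma Ale'_eq: "Ale' i d = A' i \<inter> polys_le d"
  by (auto simp: poly_ring_le_def polys_le_def mon_deg_def)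

lemma ext_add: "ext i (p + q) = ext i p + ext i q"
  and ext_mult: "ext i (p * q) = ext i p * ext i q"
  and ext_uminus: "ext i (- p) = - ext i p"
  and ext_0 [simp]: "ext i 0 = 0"
  and ext_1 [simp]: "ext i 1 = 1"
  and ext_pconst [simp]: "ext i (pconst c) = pconst c"
  and ext_sum: "ext i (sum f S) = (\<Sum>j\<in>S. ext i (f j))"
  by (simp_all add: ext_def psubst_add psubst_mult psubst_uminus psubst_sum)

lemma ext_in: "p \<in> A' i \<Longrightarrow> ext i p \<in> A"
  unfolding poly_ring_eq A'_eq ext_def by (rule psubst_in[OF _ pull_in])

lemma cores_in: "p \<in> A \<Longrightarrow> cores i p \<in> A' i"
  unfolding poly_ring_eq A'_eq cores_def by (rule psubst_in[OF _ pull_in])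

lemma ext_le: "p \<in> Ale' i d \<Longrightarrow> ext i p \<in> Ale d"
  using ext_in by (auto simp: Ale'_eq poly_ring_le_eq ext_def psubst_le[OF _ pull_le])

text \<open>Projection after inclusion is the identity of \<open>W i\<close>. The resulting
  injectivity of \<open>ext i\<close> keeps denominators and traces nonzero.\<close>

lemma cores_ext:
  assumes i: "i \<in> I" and p: "p \<in> A' i"
  shows "cores i (ext i p) = p"
proof -
  let ?b = "basis_of scale V" and ?b' = "basis_of scale (W i)"
  have "psubst (pull scale ?b' ?b id) (pull scale ?b ?b' (pr i) l) = pvar l" if l: "l < length ?b'" for l
  proof -
    have "psubst (pull scale ?b' ?b id) (pull scale ?b ?b' (pr i) l) = pull scale ?b' ?b' (pr i \<circ> id) l"
      using W_subset[OF i] basis_W_in[OF i]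
      by (intro psubst_pull_pull[OF basis basis_W[OF i]]) (auto intro: pr_linear pr_mem i)
    also have "\<dots> = pvar l"
      using basis_W_in[OF i] by (intro pull_id[OF basis_W[OF i] l]) (simp add: pr_W i)
    finally show ?thesis .
  qed
  then have "cores i (ext i p) = psubst pvar p"
    unfolding cores_def ext_def psubst_psubst using p unfolding A'_eq by (intro psubst_cong) auto
  then show ?thesis by simp
qed

lemma ext_eq_0_iff: "i \<in> I \<Longrightarrow> p \<in> A' i \<Longrightarrow> ext i p = 0 \<longleftrightarrow> p = 0"
  using cores_ext[of i p] by (auto simp: cores_def)

text \<open>Contravariance turns the equivariance \<open>pr_rho\<close> of the projection into that
  of its pullback.\<close>

lemma act_ext:
  assumes i: "i \<in> I" and g: "g \<in> carrier G"
  shows "act g (ext i p) = ext i (act' i (res i g) p)"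
proof -
  let ?b = "basis_of scale V" and ?b' = "basis_of scale (W i)"
  interpret R: faithful_rep "Gr i" scale "W i" "\<lambda>f. f" by (rule faithful_rep_Gr[OF i])
  have g': "inv\<^bsub>G\<^esub> g \<in> carrier G" using g by simp
  have res: "res i (inv\<^bsub>G\<^esub> g) \<in> carrier (Gr i)" using g' by (simp add: carrier_Gr)
  have "psubst (pull scale ?b ?b (\<rho> (inv\<^bsub>G\<^esub> g))) (pull scale ?b ?b' (pr i) l)
      = psubst (pull scale ?b ?b' (pr i)) (pull scale ?b' ?b' (inv\<^bsub>Gr i\<^esub> (res i g)) l)" for l
  proof -
    have "psubst (pull scale ?b ?b (\<rho> (inv\<^bsub>G\<^esub> g))) (pull scale ?b ?b' (pr i) l)
        = pull scale ?b ?b' (pr i \<circ> \<rho> (inv\<^bsub>G\<^esub> g)) l"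
      by (intro psubst_pull_pull[OF basis basis_W[OF i]]) (auto intro: pr_linear pr_mem i rho_closed g' basis_in)
    also have "\<dots> = pull scale ?b ?b' (res i (inv\<^bsub>G\<^esub> g) \<circ> pr i) l"
      using basis_in by (intro pull_cong) (simp add: pr_rho i g' restrict_rep_def pr_mem)
    also have "\<dots> = psubst (pull scale ?b ?b' (pr i)) (pull scale ?b' ?b' (res i (inv\<^bsub>G\<^esub> g)) l)"
      using basis_in pr_mem[OF _ i] R.rho_closed[OF res] R.rho_linear[OF res]
      by (intro psubst_pull_pull[OF basis_W[OF i] basis_W[OF i], symmetric]) auto
    finally show ?thesis by (simp add: inv_res[OF i g])
  qed
  then show ?thesis by (simp add: poly_act_eq ext_def psubst_psubst)
qed

lemma ext_Inv:
  assumes "i \<in> I" "p \<in> Inv' i"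
  shows "ext i p \<in> Inv"
  using assms act_ext[of i _ p] by (auto simp: Inv_iff poly_inv_def ext_in carrier_Gr)

text \<open>The identity of \<open>V\<close> is the sum of the projections followed by inclusions.
  Hence each coordinate function is a sum of functions that come from the summands.\<close>

lemma sum_ext_cores:
  assumes l: "l < dm"
  shows "(\<Sum>i\<in>I. ext i (cores i (pvar l))) = pvar l"
proof -
  let ?b = "basis_of scale V"
  have "ext i (cores i (pvar l)) = pull scale ?b ?b (pr i) l" if i: "i \<in> I" for i
  proof -
    have "ext i (cores i (pvar l)) = pull scale ?b ?b (id \<circ> pr i) l"
      unfolding ext_def cores_def psubst_pvar using W_subset[OF i]
      by (intro psubst_pull_pull[OF basis_W[OF i] basis])
        (auto intro: pr_mem i basis_in simp: linear_map_on_def)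
    then show ?thesis by simp
  qed
  then have "(\<Sum>i\<in>I. ext i (cores i (pvar l))) = (\<Sum>i\<in>I. pull scale ?b ?b (pr i) l)" by simp
  also have "\<dots> = pull scale ?b ?b (\<lambda>v. \<Sum>i\<in>I. pr i v) l"
    using W_subset pr_mem basis_in by (intro pull_sum[OF basis]) blast
  also have "\<dots> = pvar l"
    using basis_in by (intro pull_id[OF basis l]) (simp add: pr_sum)
  finally show ?thesis .
qed

text \<open>The images of pure tensors under the multiplication map from the tensor product of the
  k[V_i] to k[V].\<close>

definition products :: "'k mpoly set" where
  "products = {\<Prod>i\<in>I. ext i (f i) | f. \<forall>i\<in>I. f i \<in> A' i}"

lemma productsI: "(\<And>i. i \<in> I \<Longrightarrow> f i \<in> A' i) \<Longrightarrow> (\<Prod>i\<in>I. ext i (f i)) \<in> products"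
  unfolding products_def by blast

lemma closed_semiring_pconst: "closed_semiring (range pconst)"
proof -
  have "0 = pconst 0" "1 = pconst 1" by simp_all
  then show ?thesis unfolding closed_semiring_def
    by (auto simp flip: pconst_add pconst_mult simp del: pconst_0 pconst_1)
qed

text \<open>Surjectivity of that multiplication map. A variable is a sum of products with 1 in all
  slots but one, and products multiply slot by slot.\<close>

lemma A_subset_products: "A \<subseteq> span_over (range pconst) products"
proof
  note R = closed_semiring_pconst
  fix p assume "p \<in> A"
  then show "p \<in> span_over (range pconst) products"
    unfolding poly_ring_eq
  proof (induction rule: polys_in_induct)
    case (const c)
    have "1 \<in> products" using productsI[of "\<lambda>_. 1"] by (simp add: A'_eq)
    then have "pconst c * 1 \<in> span_over (range pconst) products"
      by (intro span_over_scale[OF R] span_over_base closed_semiringD[OF R]) auto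
    then show ?case by simp
  next
    case (var l)
    have "ext i (cores i (pvar l)) \<in> products" if i: "i \<in> I" for i
    proof -
      let ?f = "\<lambda>j. if j = i then cores i (pvar l) else 1"
      have "(\<Prod>j\<in>I. ext j (?f j)) = (\<Prod>j\<in>I. if j = i then ext i (cores i (pvar l)) else 1)"
        by (intro prod.cong) auto
      also have "\<dots> = ext i (cores i (pvar l))" using i finite_I by simp
      finally show ?thesis
        using productsI[of ?f] cores_in[of "pvar l" i] var
        by (auto simp: A'_eq poly_ring_eq polys_in_pvar)
    qed
    then have "(\<Sum>i\<in>I. ext i (cores i (pvar l))) \<in> span_over (range pconst) products"
      by (intro span_over_sum[OF R] span_over_base closed_semiringD[OF R])
    then show ?case using sum_ext_cores var by simp
  next
    case (add p q)
    then show ?case by (rule span_over_add[OF R])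
  next
    case (mult p q)
    have "s * s' \<in> products" if ss: "s \<in> products" "s' \<in> products" for s s'
    proof -
      obtain f f' where f: "s = (\<Prod>i\<in>I. ext i (f i))" "\<And>i. i \<in> I \<Longrightarrow> f i \<in> A' i"
        "s' = (\<Prod>i\<in>I. ext i (f' i))" "\<And>i. i \<in> I \<Longrightarrow> f' i \<in> A' i"
        using ss unfolding products_def by blast
      have "s * s' = (\<Prod>i\<in>I. ext i (f i * f' i))" by (simp add: f(1,3) ext_mult prod.distrib)
      then show ?thesis using f productsI[of "\<lambda>i. f i * f' i"] by (simp add: A'_eq polys_in_mult)
    qed
    with mult show ?case by (intro span_over_mult[OF R])
  qed
qed

section \<open>Adding up the degrees of generators from the summands\<close>

lemma ext_span:
  assumes i: "i \<in> I" and "p \<in> span_over (Inv' i) (Ale' i d)"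
  shows "ext i p \<in> span_over Inv (Ale d)"
  using assms(2)
proof (induction rule: span_over_induct)
  case (add r s x)
  then show ?case
    using ext_Inv[OF i] ext_le closed_semiringD(2)[OF closed_semiring_Inv]
    by (simp add: ext_add ext_mult span_over_add[OF closed_semiring_Inv] span_over_scale[OF closed_semiring_Inv]
        span_over_base)
qed (simp add: span_over_0)

lemma prod_ext_span:
  assumes "\<And>i. i \<in> I \<Longrightarrow> f i \<in> span_over (Inv' i) (Ale' i (d i))"
  shows "(\<Prod>i\<in>I. ext i (f i)) \<in> span_over Inv (Ale (\<Sum>i\<in>I. d i))"
  using assms by (intro span_over_prod[OF closed_semiring_Inv finite_I] ext_span Ale_1 Ale_mult)

theorem topdeg_direct_sum:
  "topdeg scale G V \<rho> \<le> (\<Sum>i\<in>I. topdeg scale (Gr i) (W i) (\<lambda>f. f))"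
proof (rule topdeg_le, rule subsetI)
  note R = closed_semiring_Inv
  let ?d = "\<lambda>i. topdeg scale (Gr i) (W i) (\<lambda>f. f)"
  fix p assume "p \<in> A"
  then have "p \<in> span_over (range pconst) products" using A_subset_products by blast
  then show "p \<in> span_over Inv (Ale (\<Sum>i\<in>I. ?d i))"
  proof (induction rule: span_over_induct)
    case (add r s x)
    obtain f where f: "s = (\<Prod>i\<in>I. ext i (f i))" "\<And>i. i \<in> I \<Longrightarrow> f i \<in> A' i"
      using add unfolding products_def by blast
    have "s \<in> span_over Inv (Ale (\<Sum>i\<in>I. ?d i))"
      unfolding f(1) using f(2) faithful_rep.topdeg_span[OF faithful_rep_Gr] by (intro prod_ext_span) blast
    then show ?case
      using add Inv_pconst by (auto intro!: span_over_add[OF R] span_over_scale[OF R])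
  qed (simp add: span_over_0)
qed

theorem D_span_direct_sum:
  "D_span scale G V \<rho> \<le> (\<Sum>i\<in>I. D_span scale (Gr i) (W i) (\<lambda>f. f))"
proof (rule D_span_le, unfold spans_field_iff, rule ballI)
  note R = closed_semiring_Inv
  let ?d = "\<lambda>i. D_span scale (Gr i) (W i) (\<lambda>f. f)"
  fix p assume "p \<in> A"
  then have "p \<in> span_over (range pconst) products" using A_subset_products by blast
  then show "\<exists>q\<in>Inv. q \<noteq> 0 \<and> q * p \<in> span_over Inv (Ale (\<Sum>i\<in>I. ?d i))"
  proof (induction rule: span_over_induct)
    case zero
    then show ?case using closed_semiringD(2)[OF R] span_over_0 by (intro bexI[of _ 1]) auto
  next
    case (add r s x)
    obtain f where f: "s = (\<Prod>i\<in>I. ext i (f i))" "\<And>i. i \<in> I \<Longrightarrow> f i \<in> A' i"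
      using add unfolding products_def by blast
    have "\<exists>q\<in>Inv' i. q \<noteq> 0 \<and> q * f i \<in> span_over (Inv' i) (Ale' i (?d i))" if i: "i \<in> I" for i
    proof -
      interpret R: faithful_rep "Gr i" scale "W i" "\<lambda>f. f" by (rule faithful_rep_Gr[OF i])
      show ?thesis using R.D_span_spans f(2)[OF i] unfolding R.spans_field_iff by blast
    qed
    then obtain q where q: "\<And>i. i \<in> I \<Longrightarrow> q i \<in> Inv' i" "\<And>i. i \<in> I \<Longrightarrow> q i \<noteq> 0"
      "\<And>i. i \<in> I \<Longrightarrow> q i * f i \<in> span_over (Inv' i) (Ale' i (?d i))" by metis
    \<comment> \<open>One denominator for the whole product. Injectivity of the maps
      \<open>ext i\<close> and the absence of zero divisors keep it nonzero.\<close>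
    define Q where "Q = (\<Prod>i\<in>I. ext i (q i))"
    have "Q \<in> Inv" unfolding Q_def by (intro closed_semiring_prod[OF R] ext_Inv q(1))
    moreover have "q i \<in> A' i" if "i \<in> I" for i using q(1)[OF that] by (simp add: poly_inv_def)
    then have "Q \<noteq> 0" unfolding Q_def using q(2) finite_I by (simp add: ext_eq_0_iff)
    ultimately have Q: "Q \<in> Inv" "Q \<noteq> 0" by auto
    have "Q * s \<in> span_over Inv (Ale (\<Sum>i\<in>I. ?d i))"
      unfolding Q_def f(1) prod.distrib[symmetric] ext_mult[symmetric] using q(3) by (rule prod_ext_span)
    moreover obtain q' where q': "q' \<in> Inv" "q' \<noteq> 0" "q' * x \<in> span_over Inv (Ale (\<Sum>i\<in>I. ?d i))"
      using add.IH by blast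
    moreover have "r \<in> Inv" using add Inv_pconst by auto
    \<comment> \<open>\<open>Q\<close> clears the new term and \<open>q'\<close> the sum so far; the
      constant \<open>r\<close> is an invariant.\<close>
    moreover have "(Q * q') * (r * s + x) = (q' * r) * (Q * s) + Q * (q' * x)" by (simp add: algebra_simps)
    ultimately have "(Q * q') * (r * s + x) \<in> span_over Inv (Ale (\<Sum>i\<in>I. ?d i))"
      using Q closed_semiringD(4)[OF R] by (simp add: span_over_add[OF R] span_over_scale[OF R])
    then show ?case using Q q' closed_semiringD(4)[OF R] by (intro bexI[of _ "Q * q'"]) auto
  qed
qed

section \<open>The natural map into the product of the image groups\<close>

lemma natural_map_hom: "natural_map \<rho> I W \<in> hom G (product_group I Gr)"
proof (rule homI)
  fix g h assume "g \<in> carrier G" "h \<in> carrier G"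
  then show "natural_map \<rho> I W (g \<otimes>\<^bsub>G\<^esub> h)
      = natural_map \<rho> I W g \<otimes>\<^bsub>product_group I Gr\<^esub> natural_map \<rho> I W h"
    using res_hom by (auto simp: natural_map_def hom_def intro!: restrict_ext)
qed (simp add: natural_map_def carrier_Gr)

text \<open>Elements that agree on every summand agree on sums of components, that is on
  \<open>V\<close>; faithfulness finishes.\<close>

lemma natural_map_inj: "inj_on (natural_map \<rho> I W) (carrier G)"
proof (rule inj_onI)
  fix g h assume g: "g \<in> carrier G" and h: "h \<in> carrier G"
    and eq: "natural_map \<rho> I W g = natural_map \<rho> I W h"
  have "\<rho> g w = \<rho> h w" if "i \<in> I" "w \<in> W i" for i w
    using fun_cong[OF fun_cong[OF eq, of i], of w] that by (simp add: natural_map_def restrict_rep_def)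
  then have "\<rho> g v = \<rho> h v" if "v \<in> V" for v
    using that pr_mem by (simp add: rho_sum_pr g h)
  then have "\<rho> g = \<rho> h"
    using g h rho_Bij by (intro extensionalityI[of _ V]) (auto intro: Bij_imp_extensional)
  then show "g = h" using inj g h by (auto dest: inj_onD)
qed

lemma natural_map_subdirect: "subdirect_product I Gr (natural_map \<rho> I W ` carrier G)"
  unfolding subdirect_product_def
proof (intro conjI ballI)
  show "subgroup (natural_map \<rho> I W ` carrier G) (product_group I Gr)"
    by (rule group_hom.img_is_subgroup)
      (simp add: group_hom_def group_hom_axioms_def natural_map_hom G.is_group group_Gr)
  show "(\<lambda>x. x i) ` natural_map \<rho> I W ` carrier G = carrier (Gr i)" if "i \<in> I" for i
    using that by (simp add: image_image natural_map_def carrier_Gr)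
qed

text \<open>Morally the field embedding induced by \<open>ext i\<close> applied to a generated
  field. Instead of building that embedding on fractions, the induction carries a representation
  \<open>Fract a b\<close> whose image quotient lies in the target field.\<close>

lemma ext_inv_field:
  assumes i: "i \<in> I" and d: "beta_field scale (Gr i) (W i) (\<lambda>f. f) \<le> d" and p: "p \<in> Inv' i"
  shows "to_fract (ext i p) \<in> inv_field d"
proof -
  interpret R: faithful_rep "Gr i" scale "W i" "\<lambda>f. f" by (rule faithful_rep_Gr[OF i])
  have "\<exists>a\<in>A' i. \<exists>b\<in>A' i. b \<noteq> 0 \<and> x = Fract a b \<and> to_fract (ext i a) / to_fract (ext i b) \<in> inv_field d"
    if "x \<in> R.inv_field (beta_field scale (Gr i) (W i) (\<lambda>f. f))" for x
    using that
  proof (induction rule: gen_field_induct)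
    case one
    show ?case
      by (intro bexI[of _ 1]) (simp_all add: gen_field_1 R.A_1 flip: One_fract_def)
  next
    case (incl x)
    then obtain y where y: "x = to_fract y" "y \<in> range pconst \<or> y \<in> Inv' i \<and> y \<in> Ale' i (beta_field scale (Gr i) (W i) (\<lambda>f. f))"
      by blast
    have "y \<in> A' i" using y(2) R.A_pconst by (auto simp: R.Inv_iff)
    moreover have "to_fract (ext i y) \<in> inv_field d"
    proof (cases "y \<in> range pconst")
      case True
      then show ?thesis by (auto intro: generate_field.incl)
    next
      case False
      then show ?thesis using y(2) d R.Ale_mono[OF d] ext_Inv[OF i] ext_le by (intro inv_field_incl) blast+
    qed
    ultimately show ?case
      by (intro bexI[of _ y] bexI[of _ 1]) (auto simp: y(1) to_fract_def R.A_1 simp flip: One_fract_def)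
  next
    case (uminus x)
    then obtain a b where "a \<in> A' i" "b \<in> A' i" "b \<noteq> 0" "x = Fract a b"
      "to_fract (ext i a) / to_fract (ext i b) \<in> inv_field d" by blast
    then show ?case
      using gen_field_uminus by (intro bexI[of _ "- a"] bexI[of _ b]) (fastforce simp: ext_uminus R.A_uminus)+
  next
    case (inverse x)
    then obtain a b where ab: "a \<in> A' i" "b \<in> A' i" "b \<noteq> 0" "x = Fract a b"
      "to_fract (ext i a) / to_fract (ext i b) \<in> inv_field d" by blast
    \<comment> \<open>A zero numerator would make \<open>x\<close> zero, so \<open>b / a\<close> is
      a legitimate representation of the inverse.\<close>
    then have "a \<noteq> 0" using inverse.hyps by (auto simp: fract_collapse)
    then show ?case
      using ab gen_field_inverse[OF ab(5)] by (intro bexI[of _ b] bexI[of _ a]) auto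
  next
    case (add x y)
    then obtain a b a' b' where ab: "a \<in> A' i" "b \<in> A' i" "b \<noteq> 0" "x = Fract a b"
      "to_fract (ext i a) / to_fract (ext i b) \<in> inv_field d"
      "a' \<in> A' i" "b' \<in> A' i" "b' \<noteq> 0" "y = Fract a' b'"
      "to_fract (ext i a') / to_fract (ext i b') \<in> inv_field d" by metis
    then have nz: "ext i b \<noteq> 0" "ext i b' \<noteq> 0" by (simp_all add: ext_eq_0_iff i)
    show ?case
      using ab gen_field_add[OF ab(5,10)] nz
      by (intro bexI[of _ "a * b' + a' * b"] bexI[of _ "b * b'"])
        (auto simp: R.A_add R.A_mult ext_add ext_mult add_frac_eq)
  next
    case (mult x y)
    then obtain a b a' b' where ab: "a \<in> A' i" "b \<in> A' i" "b \<noteq> 0" "x = Fract a b"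
      "to_fract (ext i a) / to_fract (ext i b) \<in> inv_field d"
      "a' \<in> A' i" "b' \<in> A' i" "b' \<noteq> 0" "y = Fract a' b'"
      "to_fract (ext i a') / to_fract (ext i b') \<in> inv_field d" by metis
    show ?case
      using ab gen_field_mult[OF ab(5,10)]
      by (intro bexI[of _ "a * a'"] bexI[of _ "b * b'"]) (auto simp: R.A_mult ext_mult)
  qed
  from this[OF R.beta_field_inv[OF p]] obtain a b where ab: "a \<in> A' i" "b \<in> A' i" "b \<noteq> 0"
    "to_fract p = Fract a b" "to_fract (ext i a) / to_fract (ext i b) \<in> inv_field d" by blast
  \<comment> \<open>The representation found may differ from \<open>p / 1\<close>; cross
    multiplication lets \<open>ext i b\<close> cancel in the image.\<close>
  have "p * b = a" using ab(3,4) by (simp add: to_fract_def eq_fract)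
  then have "ext i a = ext i p * ext i b" by (simp flip: ext_mult)
  moreover have "ext i b \<noteq> 0" using ab by (simp add: ext_eq_0_iff i)
  ultimately show ?thesis using ab(5) by simp
qed

text \<open>The place where directness enters: reindexed along the isomorphism, the components of
  \<open>g\<close> run independently, and the sum of products becomes a product of sums.\<close>

lemma Tr_prod_ext:
  assumes iso: "natural_map \<rho> I W \<in> iso G (product_group I Gr)"
  shows "Tr (\<Prod>i\<in>I. ext i (f i)) = (\<Prod>i\<in>I. ext i (Tr' i (f i)))"
proof -
  have bij: "bij_betw (natural_map \<rho> I W) (carrier G) (\<Pi>\<^sub>E i\<in>I. carrier (Gr i))"
    using iso by (simp add: iso_def)
  have "Tr (\<Prod>i\<in>I. ext i (f i)) = (\<Sum>g\<in>carrier G. \<Prod>i\<in>I. ext i (act' i (natural_map \<rho> I W g i) (f i)))"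
    unfolding Tr_def act_prod by (intro sum.cong prod.cong) (auto simp: act_ext natural_map_def)
  also have "\<dots> = (\<Sum>\<gamma>\<in>(\<Pi>\<^sub>E i\<in>I. carrier (Gr i)). \<Prod>i\<in>I. ext i (act' i (\<gamma> i) (f i)))"
    by (rule sum.reindex_bij_betw[OF bij])
  also have "\<dots> = (\<Prod>i\<in>I. \<Sum>\<gamma>\<in>carrier (Gr i). ext i (act' i \<gamma> (f i)))"
    by (rule prod_sum_PiE[symmetric]) (auto simp: finite_I finite_G carrier_Gr)
  also have "\<dots> = (\<Prod>i\<in>I. ext i (Tr' i (f i)))"
    by (intro prod.cong refl) (simp add: faithful_rep.Tr_def[OF faithful_rep_Gr] ext_sum)
  finally show ?thesis .
qed

theorem beta_field_direct_sum:
  assumes iso: "natural_map \<rho> I W \<in> iso G (product_group I Gr)" and "I \<noteq> {}"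
  shows "beta_field scale G V \<rho> \<le> Max ((\<lambda>i. beta_field scale (Gr i) (W i) (\<lambda>f. f)) ` I)"
proof (rule beta_field_le)
  define d where "d = Max ((\<lambda>i. beta_field scale (Gr i) (W i) (\<lambda>f. f)) ` I)"
  have d: "beta_field scale (Gr i) (W i) (\<lambda>f. f) \<le> d" if "i \<in> I" for i
    using that finite_I by (simp add: d_def)
  note F = closed_semiring_gen_field
  have Tr_products: "to_fract (Tr s) \<in> inv_field d" if s: "s \<in> products" for s
  proof -
    obtain f where f: "s = (\<Prod>i\<in>I. ext i (f i))" "\<And>i. i \<in> I \<Longrightarrow> f i \<in> A' i"
      using s unfolding products_def by blast
    have "to_fract (ext i (Tr' i (f i))) \<in> inv_field d" if i: "i \<in> I" for i
      using faithful_rep.Tr_Inv[OF faithful_rep_Gr[OF i] f(2)[OF i]] by (rule ext_inv_field[OF i d[OF i]])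
    moreover have "to_fract (prod h S) = (\<Prod>i\<in>S. to_fract (h i))" for h :: "'i \<Rightarrow> 'k mpoly" and S
      by (induction S rule: infinite_finite_induct) auto
    ultimately show ?thesis
      by (simp add: f(1) Tr_prod_ext[OF iso] closed_semiring_prod[OF F])
  qed
  \<comment> \<open>The trace is linear over the constants, so the case of products extends to all
    polynomials.\<close>
  have Tr_A: "to_fract (Tr p) \<in> inv_field d" if p: "p \<in> A" for p
  proof -
    have "p \<in> span_over (range pconst) products" using p A_subset_products by blast
    then show ?thesis
    proof (induction rule: span_over_induct)
      case zero
      show ?case by (simp add: gen_field_0)
    next
      case (add r s x)
      have "to_fract r \<in> inv_field d" using add by (auto intro: generate_field.incl)
      moreover have "r \<in> Inv" using add Inv_pconst by auto
      ultimately show ?case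
        using add Tr_products by (simp add: Tr_add Tr_mult_Inv gen_field_add gen_field_mult)
    qed
  qed
  have "\<exists>e\<in>A' i. Tr' i e \<noteq> 0" if "i \<in> I" for i
    by (rule faithful_rep.ex_Tr_nonzero[OF faithful_rep_Gr[OF that]])
  then obtain e where e: "\<And>i. i \<in> I \<Longrightarrow> e i \<in> A' i" "\<And>i. i \<in> I \<Longrightarrow> Tr' i (e i) \<noteq> 0" by metis
  \<comment> \<open>Dedekind's theorem is applied in each image group separately; the trace of
    \<open>E\<close> is the product of the embedded traces of its factors, hence nonzero.\<close>
  define E where "E = (\<Prod>i\<in>I. ext i (e i))"
  have E: "E \<in> A" unfolding E_def using e by (intro closed_semiring_prod[OF closed_semiring_A] ext_in)
  have "Tr' i (e i) \<in> A' i" if "i \<in> I" for i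
    using faithful_rep.Tr_Inv[OF faithful_rep_Gr[OF that] e(1)[OF that]] by (simp add: poly_inv_def)
  then have TrE: "Tr E \<noteq> 0"
    using e(2) finite_I by (simp add: E_def Tr_prod_ext[OF iso] ext_eq_0_iff)
  fix p assume p: "p \<in> Inv"
  have "to_fract (Tr (p * E)) / to_fract (Tr E) \<in> inv_field d"
    using p E by (intro gen_field_divide Tr_A A_mult) (auto simp: Inv_iff)
  then show "to_fract p \<in> inv_field d"
    using p TrE by (simp add: Tr_mult_Inv)
qed

end

theorem proposition4p6:
  fixes G :: "('g, 'm) monoid_scheme"
    and scale :: "'k::field \<Rightarrow> 'v::ab_group_add \<Rightarrow> 'v"
    and V :: "'v set"
    and \<rho> :: "'g \<Rightarrow> 'v \<Rightarrow> 'v"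
    and r :: nat
    and W :: "nat \<Rightarrow> 'v set"
    and Gs :: "nat \<Rightarrow> ('v \<Rightarrow> 'v) monoid"
  assumes "group G" and "finite (carrier G)"
    and "vector_space scale"
    and "findim_space scale V"
    and "linear_rep scale G V \<rho>"
    and faithful: "inj_on \<rho> (carrier G)"
    and "r \<ge> 1"
    and "\<And>j. j \<in> {1..r} \<Longrightarrow> subrep scale G \<rho> (W j)"
    and "internal_direct_sum {1..r} W V"
    and Gs: "\<And>j. j \<in> {1..r} \<Longrightarrow> Gs j = rep_image scale G \<rho> (W j)"
  shows "topdeg scale G V \<rho> \<le> (\<Sum>j=1..r. topdeg scale (Gs j) (W j) (\<lambda>f. f))
    \<and> D_span scale G V \<rho> \<le> (\<Sum>j=1..r. D_span scale (Gs j) (W j) (\<lambda>f. f))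
    \<and> natural_map \<rho> {1..r} W \<in> hom G (product_group {1..r} Gs)
    \<and> inj_on (natural_map \<rho> {1..r} W) (carrier G)
    \<and> subdirect_product {1..r} Gs (natural_map \<rho> {1..r} W ` carrier G)
    \<and> (natural_map \<rho> {1..r} W \<in> iso G (product_group {1..r} Gs) \<longrightarrow>
         beta_field scale G V \<rho> \<le> Max ((\<lambda>j. beta_field scale (Gs j) (W j) (\<lambda>f. f)) ` {1..r}))"
proof -
  interpret direct_sum_rep G scale V \<rho> "{1..r}" W
    using assms
    by (simp add: direct_sum_rep_def direct_sum_rep_axioms_def faithful_rep_def faithful_rep_axioms_def)
  \<comment> \<open>\<open>Gs\<close> is prescribed only on the index set, but the product group
    sees no other values.\<close>
  have product: "product_group {1..r} Gs = product_group {1..r} Gr"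
    unfolding product_group_def using Gs by (auto simp: fun_eq_iff restrict_def intro!: PiE_cong)
  have subdirect: "subdirect_product {1..r} Gs H \<longleftrightarrow> subdirect_product {1..r} Gr H" for H
    unfolding subdirect_product_def product using Gs by simp
  have image: "(\<lambda>j. beta_field scale (Gs j) (W j) (\<lambda>f. f)) ` {1..r}
      = (\<lambda>j. beta_field scale (Gr j) (W j) (\<lambda>f. f)) ` {1..r}"
    using Gs by (intro image_cong) auto
  show ?thesis
    unfolding product subdirect image
    using topdeg_direct_sum D_span_direct_sum natural_map_hom natural_map_inj natural_map_subdirect
      beta_field_direct_sum Gs \<open>r \<ge> 1\<close>
    by simp
qed

end
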